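(* Let $d\ge 3$ be an integer and $T=\{0\}\cup\{\frac1k : k\in\mathbb{N}_{>0}\}$. Then the boundary of $\Pi_d$ in $\mathbb{R}^{d-1}$ is the union of the patches $P_R$, where $R$ ranges over all subsets of $T$ of size $d-1$ satisfying Gale's evenness condition in $T$. Moreover, each such patch $P_R$ occurs as a boundary patch of $\tilde\Pi_{n,d}$ for all $n$ sufficiently large; that is, for all sufficiently large $n$, $R$ is a subset of $T_n=\{0\}\cup\{\frac1k:1\le k\le n\}$ satisfying Gale's evenness condition in $T_n$, and $P_R\subset\operatorname{bd}\tilde\Pi_{n,d}$.
   Context: $\Delta_{n-1}=\{x\in\mathbb{R}^n_{\geq 0}: \sum_i x_i=1\}$, $\tilde\Delta_n=\{x\in\mathbb{R}^n_{\ge0}:\sum_i x_i\le 1\}$, $p_k(x)=\sum_{i=1}^n x_i^k$, $\nu^*_{n,d}=(p_2,\dots,p_d)$. Put $\Pi_{n,d}=\nu^*_{n,d}(\Delta_{n-1})$ and $\tilde\Pi_{n,d}=\nu^*_{n,d}(\tilde\Delta_n)$, subsets of $\mathbb{R}^{d-1}$, and let $\Pi_d$ be the closure of $\bigcup_{n\ge d}\Pi_{n,d}$. Gale's evenness condition: a finite subset $R$ of $T$ (respectively of $T_n$) satisfies Gale's evenness condition in $T$ (respectively $T_n$) if for any two points $a_1,a_2\in T\setminus R$ (respectively $T_n\setminus R$) the number of points of $R$ lying between $a_1$ and $a_2$ is even. Patches: for $1\le k\le n$ let $\overline{k}=(0,\dots,0,\frac1k,\dots,\frac1k)\in\mathbb{R}^n$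 with exactly $k$ entries equal to $\frac1k$, and let $\overline{\infty}=(0,\dots,0)\in\mathbb{R}^n$. For a finite subset $R\subset T$ of size $d-1$ and any $n\geq d$ with $R\subset T_n$, let $P_R=\nu^*_{n,d}(\sigma_R)$, where $\sigma_R\subset\tilde\Delta_n$ is the simplex whose vertices are the points $\overline{k}$ for $\frac1k\in R$, together with $\overline{\infty}$ if $0\in R$. The set $P_R$ does not depend on the choice of such $n$. The vertices of the patch $P_R$ are the points $(r,r^2,\dots,r^{d-1})$, $r\in R$, which are the images of the vertices of $\sigma_R$. *)

theory Defs
  imports "HOL-Analysis.Analysis"
begin

text \<open>
  A point of \<open>\<real>\<^sup>n\<close> is a function \<open>nat \<Rightarrow> real\<close> vanishing outside the index set \<open>{1..n}\<close>,
  since \<open>n\<close> has to vary.  The space \<open>\<real>\<^sup>d\<^sup>-\<^sup>1\<close> is \<open>real ^ 'm\<close>, its coordinates being labelled by the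
  exponents \<open>2, \<dots>, d\<close> through a bijection \<open>ix :: 'm \<Rightarrow> nat\<close> onto \<open>{2..d}\<close>; in particular
  \<open>CARD('m) = d - 1\<close>.
\<close>

definition prob_simplex :: "nat \<Rightarrow> (nat \<Rightarrow> real) set" where
  "prob_simplex n =
    {x. (\<forall>i. i \<notin> {1..n} \<longrightarrow> x i = 0) \<and> (\<forall>i\<in>{1..n}. 0 \<le> x i) \<and> (\<Sum>i=1..n. x i) = 1}"

definition full_simplex :: "nat \<Rightarrow> (nat \<Rightarrow> real) set" where
  "full_simplex n =
    {x. (\<forall>i. i \<notin> {1..n} \<longrightarrow> x i = 0) \<and> (\<forall>i\<in>{1..n}. 0 \<le> x i) \<and> (\<Sum>i=1..n. x i) \<le> 1}"

definition power_sum :: "nat \<Rightarrow> nat \<Rightarrow> (nat \<Rightarrow> real) \<Rightarrow> real" where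
  "power_sum n k x = (\<Sum>i=1..n. x i ^ k)"

definition vandermonde_map :: "('m::finite \<Rightarrow> nat) \<Rightarrow> nat \<Rightarrow> (nat \<Rightarrow> real) \<Rightarrow> real ^ 'm" where
  "vandermonde_map ix n x = (\<chi> j. power_sum n (ix j) x)"

definition Pi_set :: "('m::finite \<Rightarrow> nat) \<Rightarrow> nat \<Rightarrow> (real ^ 'm) set" where
  "Pi_set ix n = vandermonde_map ix n ` prob_simplex n"

definition Pi_tilde_set :: "('m::finite \<Rightarrow> nat) \<Rightarrow> nat \<Rightarrow> (real ^ 'm) set" where
  "Pi_tilde_set ix n = vandermonde_map ix n ` full_simplex n"

definition Pi_limit :: "('m::finite \<Rightarrow> nat) \<Rightarrow> nat \<Rightarrow> (real ^ 'm) set" where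
  "Pi_limit ix d = closure (\<Union>n\<in>{d..}. Pi_set ix n)"

definition T_inf :: "real set" where
  "T_inf = {0} \<union> {1 / real k | k. k \<ge> 1}"

definition T_fin :: "nat \<Rightarrow> real set" where
  "T_fin n = {0} \<union> {1 / real k | k. 1 \<le> k \<and> k \<le> n}"

definition gale_even :: "real set \<Rightarrow> real set \<Rightarrow> bool" where
  "gale_even T R \<longleftrightarrow> finite R \<and> R \<subseteq> T \<and>
    (\<forall>a\<in>T - R. \<forall>b\<in>T - R. a < b \<longrightarrow> even (card {r\<in>R. a < r \<and> r < b}))"

definition bar_point :: "nat \<Rightarrow> nat \<Rightarrow> nat \<Rightarrow> real" where
  "bar_point n k = (\<lambda>i. if n - k < i \<and> i \<le> n then 1 / real k else 0)"

definition bar_infinity :: "nat \<Rightarrow> real" where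
  "bar_infinity = (\<lambda>i. 0)"

text \<open>
  \<open>nat \<Rightarrow> real\<close> is not an instance of \<^class>\<open>real_vector\<close>, so the convex hull of a finite set of
  points is written out as the set of convex combinations.
\<close>

definition finite_hull :: "(nat \<Rightarrow> real) set \<Rightarrow> (nat \<Rightarrow> real) set" where
  "finite_hull V =
    {(\<lambda>i. \<Sum>v\<in>V. u v * v i) | u. (\<forall>v\<in>V. (0::real) \<le> u v) \<and> sum u V = 1}"

definition patch_vertices :: "nat \<Rightarrow> real set \<Rightarrow> (nat \<Rightarrow> real) set" where
  "patch_vertices n R =
    {bar_point n k | k. 1 \<le> k \<and> k \<le> n \<and> 1 / real k \<in> R} \<union> {v. v = bar_infinity \<and> 0 \<in> R}"

definition patch_simplex :: "nat \<Rightarrow> real set \<Rightarrow> (nat \<Rightarrow> real) set" where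
  "patch_simplex n R = finite_hull (patch_vertices n R)"

text \<open>
  The choice of \<open>n\<close> is immaterial by \<open>patch_eq\<close> below.
\<close>

definition patch :: "('m::finite \<Rightarrow> nat) \<Rightarrow> nat \<Rightarrow> real set \<Rightarrow> (real ^ 'm) set" where
  "patch ix d R =
    (let n = (SOME n. n \<ge> d \<and> R \<subseteq> T_fin n) in vandermonde_map ix n ` patch_simplex n R)"

text \<open>
  \<open>rev_vertex r j\<close> is the \<open>j\<close>-th entry from the end of the vertex belonging to \<open>r\<close>; it does not
  depend on \<open>n\<close>.  These two functions only serve the proof of \<open>patch_eq\<close>.
\<close>

definition rev_vertex :: "real \<Rightarrow> nat \<Rightarrow> real" where
  "rev_vertex r j = (if r \<noteq> 0 \<and> real j * r \<le> 1 then r else 0)"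

definition vertex :: "nat \<Rightarrow> real \<Rightarrow> nat \<Rightarrow> real" where
  "vertex n r i = (if i \<in> {1..n} then rev_vertex r (n + 1 - i) else 0)"

lemma vertex_0: "vertex n 0 = bar_infinity"
  by (auto simp: vertex_def rev_vertex_def bar_infinity_def)

lemma vertex_inverse:
  assumes "1 \<le> k" "k \<le> n"
  shows "vertex n (1 / real k) = bar_point n k"
proof
  fix i
  show "vertex n (1 / real k) i = bar_point n k i"
  proof (cases "i \<in> {1..n}")
    case True
    have "real (n + 1 - i) * (1 / real k) \<le> 1 \<longleftrightarrow> n + 1 - i \<le> k"
      using assms by (simp add: divide_simps del: of_nat_diff)
    also have "\<dots> \<longleftrightarrow> n - k < i" using True assms by auto
    finally show ?thesis using True assms
      by (simp add: vertex_def rev_vertex_def bar_point_def del: of_nat_diff)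
  qed (use assms in \<open>auto simp: vertex_def bar_point_def\<close>)
qed

lemma patch_vertices_eq:
  assumes "R \<subseteq> T_fin n"
  shows "patch_vertices n R = vertex n ` R"
proof (intro equalityI subsetI)
  fix v assume "v \<in> patch_vertices n R"
  then consider k where "1 \<le> k" "k \<le> n" "1 / real k \<in> R" "v = bar_point n k"
    | "v = bar_infinity" "0 \<in> R"
    unfolding patch_vertices_def by blast
  then show "v \<in> vertex n ` R"
    by cases (metis imageI vertex_inverse, metis imageI vertex_0)
next
  fix v assume "v \<in> vertex n ` R"
  then obtain r where r: "r \<in> R" "v = vertex n r" by blast
  then consider "r = 0" | k where "1 \<le> k" "k \<le> n" "r = 1 / real k"
    using assms unfolding T_fin_def by blast
  then show "v \<in> patch_vertices n R"
  proof cases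
    case 1
    then show ?thesis using r by (simp add: patch_vertices_def vertex_0)
  next
    case (2 k)
    then show ?thesis using r vertex_inverse[of k n] unfolding patch_vertices_def by blast
  qed
qed

lemma vertex_inj: "inj_on (vertex n) (T_fin n)"
proof (rule inj_onI)
  fix r s assume r: "r \<in> T_fin n" and s: "s \<in> T_fin n" and eq: "vertex n r = vertex n s"
  show "r = s"
  proof (cases "n = 0")
    case True
    then show ?thesis using r s by (auto simp: T_fin_def)
  next
    case False
    have "vertex n t n = t" if "t \<in> T_fin n" for t
      using that False by (auto simp: T_fin_def vertex_def rev_vertex_def)
    then show ?thesis using r s eq by metis
  qed
qed

lemma patch_simplex_eq:
  assumes "R \<subseteq> T_fin n"
  shows "patch_simplex n R =
    {(\<lambda>i. \<Sum>r\<in>R. u r * vertex n r i) | u. (\<forall>r\<in>R. 0 \<le> u r) \<and> sum u R = 1}"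
proof -
  have inj: "inj_on (vertex n) R" using vertex_inj assms inj_on_subset by blast
  have 1: "(\<Sum>v\<in>vertex n ` R. u v * v i) = (\<Sum>r\<in>R. u (vertex n r) * vertex n r i)" for u i
    using inj by (simp add: sum.reindex)
  have 2: "sum u (vertex n ` R) = sum (u \<circ> vertex n) R" for u :: "_ \<Rightarrow> real"
    using inj by (simp add: sum.reindex)
  show ?thesis
    unfolding patch_simplex_def patch_vertices_eq[OF assms] finite_hull_def 1 2
  proof (intro equalityI subsetI)
    fix x assume "x \<in> {(\<lambda>i. \<Sum>r\<in>R. u (vertex n r) * vertex n r i) | u.
        (\<forall>v\<in>vertex n ` R. 0 \<le> u v) \<and> sum (u \<circ> vertex n) R = 1}"
    then obtain u where "x = (\<lambda>i. \<Sum>r\<in>R. u (vertex n r) * vertex n r i)"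
      "\<forall>v\<in>vertex n ` R. 0 \<le> u v" "sum (u \<circ> vertex n) R = 1" by blast
    then show "x \<in> {(\<lambda>i. \<Sum>r\<in>R. u r * vertex n r i) | u. (\<forall>r\<in>R. 0 \<le> u r) \<and> sum u R = 1}"
      by (intro CollectI exI[of _ "u \<circ> vertex n"]) auto
  next
    fix x assume "x \<in> {(\<lambda>i. \<Sum>r\<in>R. u r * vertex n r i) | u. (\<forall>r\<in>R. 0 \<le> u r) \<and> sum u R = 1}"
    then obtain u where u: "x = (\<lambda>i. \<Sum>r\<in>R. u r * vertex n r i)"
      "\<forall>r\<in>R. 0 \<le> u r" "sum u R = 1" by blast
    have inv: "inv_into R (vertex n) (vertex n r) = r" if "r \<in> R" for r
      using inj that by (rule inv_into_f_f)
    show "x \<in> {(\<lambda>i. \<Sum>r\<in>R. u (vertex n r) * vertex n r i) | u.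
        (\<forall>v\<in>vertex n ` R. 0 \<le> u v) \<and> sum (u \<circ> vertex n) R = 1}"
      by (intro CollectI exI[of _ "u \<circ> inv_into R (vertex n)"]) (use u inv in \<open>auto cong: sum.cong\<close>)
  qed
qed

lemma rev_vertex_zero:
  assumes "r \<in> T_fin n" "n < j"
  shows "rev_vertex r j = 0"
proof (cases "r = 0")
  case False
  then obtain k where "1 \<le> k" "k \<le> n" "r = 1 / real k" using assms by (auto simp: T_fin_def)
  then have "real j * r > 1" using assms(2) by simp
  then show ?thesis by (simp add: rev_vertex_def)
qed (simp add: rev_vertex_def)

lemma power_sum_combination:
  assumes "R \<subseteq> T_fin n" "n \<le> N" "k \<noteq> 0"
  shows "power_sum n k (\<lambda>i. \<Sum>r\<in>R. u r * vertex n r i) =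
    (\<Sum>j=1..N. (\<Sum>r\<in>R. u r * rev_vertex r j) ^ k)"
proof -
  have "power_sum n k (\<lambda>i. \<Sum>r\<in>R. u r * vertex n r i) =
      (\<Sum>i=1..n. (\<Sum>r\<in>R. u r * rev_vertex r (n + 1 - i)) ^ k)"
    by (simp add: power_sum_def vertex_def)
  also have "\<dots> = (\<Sum>j=1..n. (\<Sum>r\<in>R. u r * rev_vertex r j) ^ k)"
    by (rule sum.reindex_bij_witness[of _ "\<lambda>j. n + 1 - j" "\<lambda>j. n + 1 - j"]) auto
  also have "\<dots> = (\<Sum>j=1..N. (\<Sum>r\<in>R. u r * rev_vertex r j) ^ k)"
  proof (rule sum.mono_neutral_left)
    show "\<forall>j\<in>{1..N} - {1..n}. (\<Sum>r\<in>R. u r * rev_vertex r j) ^ k = 0"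
    proof
      fix j assume "j \<in> {1..N} - {1..n}"
      then have "(\<Sum>r\<in>R. u r * rev_vertex r j) = 0"
        using assms(1) rev_vertex_zero[of _ n j] by (intro sum.neutral) auto
      then show "(\<Sum>r\<in>R. u r * rev_vertex r j) ^ k = 0" using assms(3) by simp
    qed
  qed (use assms in auto)
  finally show ?thesis .
qed

lemma patch_simplex_image_eq:
  fixes ix :: "'m::finite \<Rightarrow> nat"
  assumes ix: "\<And>j. ix j \<noteq> 0" and R: "R \<subseteq> T_fin n" "R \<subseteq> T_fin n'"
  shows "vandermonde_map ix n ` patch_simplex n R = vandermonde_map ix n' ` patch_simplex n' R"
proof -
  have "vandermonde_map ix n (\<lambda>i. \<Sum>r\<in>R. u r * vertex n r i) =
      vandermonde_map ix n' (\<lambda>i. \<Sum>r\<in>R. u r * vertex n' r i)" for u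
    using R ix by (simp add: vandermonde_map_def power_sum_combination[where N = "max n n'"])
  note eq = this
  have "vandermonde_map ix m ` patch_simplex m R =
      {vandermonde_map ix m (\<lambda>i. \<Sum>r\<in>R. u r * vertex m r i) | u.
        (\<forall>r\<in>R. 0 \<le> u r) \<and> sum u R = 1}" if "R \<subseteq> T_fin m" for m
    unfolding patch_simplex_eq[OF that] by blast
  then show ?thesis using R eq by simp
qed

lemma patch_eq:
  fixes ix :: "'m::finite \<Rightarrow> nat"
  assumes "bij_betw ix UNIV {2..d}" "n \<ge> d" "R \<subseteq> T_fin n"
  shows "patch ix d R = vandermonde_map ix n ` patch_simplex n R"
proof -
  have ix: "ix j \<noteq> 0" for j
    using bij_betw_apply[OF assms(1), of j] by auto
  have "R \<subseteq> T_fin (SOME n. n \<ge> d \<and> R \<subseteq> T_fin n)"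
    using someI[of "\<lambda>n. n \<ge> d \<and> R \<subseteq> T_fin n" n] assms by blast
  from patch_simplex_image_eq[OF ix this assms(3)] show ?thesis
    unfolding patch_def Let_def .
qed

end

theory Submission
  imports Defs "HOL-Computational_Algebra.Polynomial"
begin

text \<open>
  A point of the Kingman simplex is a decreasing sequence \<open>x\<^sub>1 \<ge> x\<^sub>2 \<ge> \<dots> \<ge> 0\<close> of sum at most \<open>1\<close>.  The power sums
  \<open>p\<^sub>k\<close> with \<open>k \<ge> 2\<close> are continuous on this compact space (because \<open>i x\<^sub>i \<le> 1\<close>), and mass that is spread
  over many tiny entries becomes invisible to them; so \<open>\<Pi>\<^sub>d\<close> is exactly the image of the Kingman simplex
  under \<open>(p\<^sub>2, \<dots>, p\<^sub>d)\<close>.  The simplex \<open>\<sigma>\<^sub>R\<close> consists of the sequences that drop only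
  after the indices \<open>k\<close> with \<open>1/k \<in> R\<close> and have sum \<open>1\<close> unless \<open>0 \<in> R\<close>.  As \<open>0\<close> is the only limit point of \<open>T\<close>,
  Gale's condition for \<open>R\<close> says that the index set \<open>J = {k. 1/k \<in> R}\<close> has an even number of
  elements above every \<open>b \<ge> 1\<close> outside \<open>J\<close> (\<open>tail_even\<close>).  So it has to be shown that the boundary is
  the image of the sequences whose drops lie in such a set \<open>J\<close>, of size \<open>d - 1\<close> for sequences of sum \<open>1\<close>, and of
  size \<open>d - 2\<close> in general (\<open>gale_seqs\<close>).

  These images lie on the boundary because \<open>p\<^sub>d\<close> is extremal there among the sequences with the same
  \<open>p\<^sub>2, \<dots>, p\<^bsub>d-1\<^esub>\<close>.  Let \<open>x\<close> have its drops in \<open>J\<close>, and let \<open>y\<close> be any competitor.  The evenness of \<open>J\<close>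
  allows one to place \<open>card J\<close> roots so that a polynomial \<open>P\<close> with leading coefficient \<open>\<plusminus>1\<close> is \<open>\<ge> 0\<close> between
  \<open>y\<^sub>i\<close> and \<open>x\<^sub>i\<close> whenever \<open>y\<^sub>i < x\<^sub>i\<close> and \<open>\<le> 0\<close> there whenever \<open>x\<^sub>i < y\<^sub>i\<close>, for all \<open>i\<close> at once
  (\<open>tail_even_sign_poly\<close>); the sign of the leading coefficient depends on \<open>card J\<close> only.  Summing the increments
  of an antiderivative gives a linear inequality between the power sums of \<open>x\<close> and \<open>y\<close> which reduces to one
  for \<open>p\<^sub>d\<close> (\<open>kingman_extremal\<close>).

  Conversely, the boundary points that are nearest to some exterior point are dense in the
  boundary, and at such a point \<open>\<nu>(x)\<close> there is a nonzero linear functional \<open>c\<close> that \<open>x\<close> maximises up to a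
  quadratic error.  Moving mass between two entries, splitting two equal entries and creating a
  new small entry yield first and second order conditions on \<open>F(t) = \<Sum>\<^sub>k c\<^sub>k t\<^sup>k\<close>: for some constant \<open>\<mu>\<close>, the
  polynomial \<open>Q = \<mu> - F'\<close> vanishes at all positive entries, does not decrease at repeated ones, and is not negative at \<open>0\<close>.
  Two consecutive roots at which \<open>Q\<close> increases enclose another root; counting roots
  shows that the drops of \<open>x\<close> can be completed to a tail-even set with at most \<open>degree Q\<close> elements
  (\<open>tail_even_cover_of_roots\<close>).  Hence a dense part of the boundary comes from
  \<open>gale_seqs\<close>, and as the image of \<open>gale_seqs\<close> is closed (\<open>closed_psum_vec_gale_seqs\<close>), all of it does.

  A patch is contained in \<open>\<Pi>\<^bsub>n,d\<^esub>\<close> with tilde, hence in \<open>\<Pi>\<^sub>d\<close>, for all large \<open>n\<close>; lying on the boundary of the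
  larger set \<open>\<Pi>\<^sub>d\<close>, it also lies on the boundary of the smaller one.
\<close>

section \<open>Gale evenness of finite index sets\<close>

text \<open>
  This is Gale's condition for the set of the numbers \<open>1/k\<close> with \<open>k \<in> J\<close>, with or without the point \<open>0\<close>: since
  the points of \<open>T\<close> accumulate at \<open>0\<close>, the point of comparison on the left can be taken
  below all of these numbers.  In other words, \<open>J\<close> is an initial segment of the positive integers
  together with disjoint pairs of consecutive integers.
\<close>

definition tail_even :: "nat set \<Rightarrow> bool" where
  "tail_even J \<longleftrightarrow> finite J \<and> 0 \<notin> J \<and> (\<forall>b\<ge>1. b \<notin> J \<longrightarrow> even (card {j\<in>J. b < j}))"

lemma tail_evenD:
  assumes "tail_even J"
  shows "finite J" "0 \<notin> J" "\<And>b. 1 \<le> b \<Longrightarrow> b \<notin> J \<Longrightarrow> even (card {j\<in>J. b < j})"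
  using assms by (auto simp: tail_even_def)

lemma tail_even_empty: "tail_even {}"
  by (simp add: tail_even_def)

lemma tail_even_one: "tail_even {1}"
proof -
  have "{j\<in>{1::nat}. b < j} = {}" if "1 \<le> b" for b using that by auto
  then show ?thesis unfolding tail_even_def by (metis card.empty even_zero finite.emptyI finite.insertI singletonD zero_neq_one)
qed

lemma tail_even_insert_pair:
  assumes "tail_even J" "\<And>j. j \<in> J \<Longrightarrow> j < k" "1 \<le> k"
  shows "tail_even (insert k (insert (Suc k) J))"
  unfolding tail_even_def
proof (intro conjI allI impI)
  fix b assume b: "1 \<le> b" "b \<notin> insert k (insert (Suc k) J)"
  note J = tail_evenD[OF assms(1)]
  show "even (card {j \<in> insert k (insert (Suc k) J). b < j})"
  proof (cases "b < k")
    case True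
    then have "{j \<in> insert k (insert (Suc k) J). b < j} = insert k (insert (Suc k) {j\<in>J. b < j})"
      by auto
    moreover have "k \<notin> {j\<in>J. b < j}" "Suc k \<notin> {j\<in>J. b < j}" "finite {j\<in>J. b < j}"
      using assms(2)[of k] assms(2)[of "Suc k"] J(1) by auto
    ultimately show ?thesis using J(3)[of b] b by simp
  next
    case False
    then have "{j \<in> insert k (insert (Suc k) J). b < j} = {}"
      using b assms(2) by force
    then show ?thesis by (metis card.empty even_zero)
  qed
qed (use assms tail_evenD[OF assms(1)] in auto)

text \<open>
  If the maximum \<open>k + 1\<close> were isolated, it would be the only element above \<open>k\<close>, which is an odd number.
\<close>

lemma tail_even_remove_pair:
  assumes "tail_even J" "Suc k \<in> J" "\<And>j. j \<in> J \<Longrightarrow> j \<le> Suc k" "1 \<le> k"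
  shows "k \<in> J" "tail_even (J - {k, Suc k})"
proof -
  note J = tail_evenD[OF assms(1)]
  show kJ: "k \<in> J"
  proof (rule ccontr)
    assume "k \<notin> J"
    moreover have "{j\<in>J. k < j} = {Suc k}" using assms(2,3) by force
    ultimately show False using J(3)[of k] assms(4) by simp
  qed
  show "tail_even (J - {k, Suc k})"
    unfolding tail_even_def
  proof (intro conjI allI impI)
    fix b assume b: "1 \<le> b" "b \<notin> J - {k, Suc k}"
    show "even (card {j \<in> J - {k, Suc k}. b < j})"
    proof (cases "b < k")
      case True
      then have "{j \<in> J. b < j} = insert k (insert (Suc k) {j \<in> J - {k, Suc k}. b < j})"
        using kJ assms(2) by auto
      then have "card {j \<in> J. b < j} = Suc (Suc (card {j \<in> J - {k, Suc k}. b < j}))"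
        using J(1) by simp
      then show ?thesis using J(3)[of b] b True by auto
    next
      case False
      then have "{j \<in> J - {k, Suc k}. b < j} = {}" using assms(3) by force
      then show ?thesis by (metis card.empty even_zero)
    qed
  qed (use J in auto)
qed

text \<open>
  A tail-even set is built from below by adding pairs of consecutive numbers, starting from the
  empty set or from \<open>{1}\<close>.  Both the construction of polynomials with prescribed signs
  and the counting of roots work pair by pair.
\<close>

lemma tail_even_induct [consumes 1, case_names empty one pair]:
  assumes "tail_even J"
    and "P {}" "P {1}"
    and pair: "\<And>J k. tail_even J \<Longrightarrow> (\<And>j. j \<in> J \<Longrightarrow> j < k) \<Longrightarrow> 1 \<le> k \<Longrightarrow> P J \<Longrightarrow>
      P (insert k (insert (Suc k) J))"
  shows "P J"
  using assms(1)
proof (induction "card J" arbitrary: J rule: less_induct)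
  case less
  note J = tail_evenD[OF less.prems]
  show ?case
  proof (cases "J = {}")
    case False
    define m where "m = Max J"
    have m: "m \<in> J" "\<And>j. j \<in> J \<Longrightarrow> j \<le> m" using J(1) False by (auto simp: m_def)
    obtain k where k: "m = Suc k" using m(1) J(2) by (cases m) auto
    show ?thesis
    proof (cases "k = 0")
      case True
      have "j = 1" if "j \<in> J" for j
        using m(2)[OF that] that J(2) k True by (cases j) auto
      moreover have "1 \<in> J" using m(1) k True by simp
      ultimately have "J = {1}" by blast
      then show ?thesis using assms(3) by (rule ssubst)
    next
      case False
      define J' where "J' = J - {k, Suc k}"
      have r: "k \<in> J" "tail_even J'"
        using tail_even_remove_pair[of J k] less.prems m k False by (auto simp: J'_def)
      have "J = insert k (insert (Suc k) J')" using r(1) m(1) unfolding J'_def k by blast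
      moreover have "card J' < card J" unfolding J'_def
        using r J(1) by (intro psubset_card_mono) auto
      moreover have "j < k" if "j \<in> J'" for j
        using m(2)[of j] that k by (auto simp: J'_def)
      ultimately show ?thesis using pair[OF r(2) _ _ less.hyps[OF _ r(2)], of k] False
        by (metis One_nat_def Suc_leI neq0_conv)
    qed
  qed (use assms in simp)
qed

text \<open>
  Filling the first gap changes no count of elements above a number that is still missing.
\<close>

lemma tail_even_insert_least:
  assumes "tail_even J"
  obtains a where "a \<notin> J" "tail_even (insert a J)"
proof -
  note J = tail_evenD[OF assms]
  have "infinite ({1::nat..} - J)" using J(1) by (simp add: infinite_Ici)
  then have ex: "\<exists>a::nat. 1 \<le> a \<and> a \<notin> J" by (metis Diff_iff atLeast_iff ex_in_conv finite.emptyI)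
  define a where "a = (LEAST a. 1 \<le> a \<and> a \<notin> J)"
  have a: "1 \<le> a" "a \<notin> J" using LeastI_ex[OF ex] by (auto simp: a_def)
  have le: "a \<le> b" if "1 \<le> b" "b \<notin> J" for b
    unfolding a_def using that by (intro Least_le) auto
  have "tail_even (insert a J)"
    unfolding tail_even_def
  proof (intro conjI allI impI)
    fix b assume b: "1 \<le> b" "b \<notin> insert a J"
    then have "{j\<in>insert a J. b < j} = {j\<in>J. b < j}" using le[of b] by auto
    then show "even (card {j\<in>insert a J. b < j})" using J(3)[of b] b by simp
  qed (use a J in auto)
  then show ?thesis using that a by blast
qed

lemma tail_even_extend:
  assumes "tail_even J" "card J \<le> n"
  obtains J' where "tail_even J'" "J \<subseteq> J'" "card J' = n"
proof -
  have "\<exists>J'. tail_even J' \<and> J \<subseteq> J' \<and> card J' = n"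
    using assms(2)
  proof (induction n rule: dec_induct)
    case base
    then show ?case using assms(1) by blast
  next
    case (step n)
    then obtain J' where J': "tail_even J'" "J \<subseteq> J'" "card J' = n" by blast
    obtain a where "a \<notin> J'" "tail_even (insert a J')" using tail_even_insert_least[OF J'(1)] .
    then show ?case using J' tail_evenD(1)[OF J'(1)] by (intro exI[of _ "insert a J'"]) auto
  qed
  then show ?thesis using that by blast
qed

section \<open>Sign patterns at roots force evenness\<close>

lemma nonneg_of_mult_pos:
  fixes a b :: real
  shows "0 \<le> a * b \<Longrightarrow> 0 < a \<Longrightarrow> 0 \<le> b"
  by (simp add: zero_le_mult_iff)

text \<open>
  A polynomial that is not negative at \<open>l\<close> cannot reach its root \<open>u\<close> from below for the first time: a
  nonnegative slope at \<open>u\<close> forces a second root \<open>z\<close> between \<open>l\<close> and \<open>u\<close>, or a double root at \<open>u\<close>.  After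
  both roots are divided out, the nonnegative sign survives at \<open>l\<close> or at \<open>u\<close>, so that the
  argument can be repeated to the right of that point.
\<close>

lemma split_double_root:
  fixes Q :: "real poly"
  assumes "l < u" "poly Q u = 0" "0 \<le> poly Q l" "0 \<le> poly (pderiv Q) u"
  obtains z m Q2 where "l \<le> z" "z \<le> u" "Q = [:-u, 1:] * ([:-z, 1:] * Q2)"
    "m = l \<or> m = u" "0 \<le> poly Q2 m"
proof -
  obtain Q1 where Q1: "Q = [:-u, 1:] * Q1"
    using assms(2) by (auto simp: poly_eq_0_iff_dvd dvd_def)
  have "poly (pderiv Q) u = poly Q1 u" unfolding Q1 pderiv_mult by (simp add: pderiv_pCons)
  then have u1: "0 \<le> poly Q1 u" using assms(4) by simp
  have "poly Q l = (l - u) * poly Q1 l" unfolding Q1 by (simp add: algebra_simps)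
  then have l1: "poly Q1 l \<le> 0" using assms(1,3) by (smt (verit) mult_neg_pos)
  show ?thesis
  proof (cases "poly Q1 u = 0")
    case True
    then obtain Q2 where Q2: "Q1 = [:-u, 1:] * Q2" by (auto simp: poly_eq_0_iff_dvd dvd_def)
    have "poly Q1 l = (l - u) * poly Q2 l" unfolding Q2 by (simp add: algebra_simps)
    then have "0 \<le> poly Q2 l" using assms(1) l1 by (smt (verit) mult_neg_neg)
    then show ?thesis using that[of u Q2 l] assms(1) Q1 Q2 by auto
  next
    case False
    obtain z where z: "l \<le> z" "z \<le> u" "poly Q1 z = 0"
      using IVT'[of "poly Q1" l 0 u] l1 u1 assms(1) continuous_on_poly[OF continuous_on_id] by fastforce
    then obtain Q2 where Q2: "Q1 = [:-z, 1:] * Q2" by (auto simp: poly_eq_0_iff_dvd dvd_def)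
    have "poly Q1 u = (u - z) * poly Q2 u" unfolding Q2 by (simp add: algebra_simps)
    moreover have "z < u" using z False by (cases "z = u") auto
    ultimately have "0 \<le> poly Q2 u" using u1 by (smt (verit) mult_pos_neg)
    then show ?thesis using that[of z Q2 u] z Q1 Q2 by auto
  qed
qed

text \<open>
  The largest index \<open>N\<close> of \<open>J\<close> belongs to the smallest root.  If \<open>N - 1 \<in> J\<close>, the pair \<open>{N - 1, N}\<close> uses up
  the two roots \<open>x N\<close> and \<open>x (N - 1)\<close>.  Otherwise \<open>N - 1\<close> is added to the cover, and the slope condition
  at \<open>x N\<close> provides the second root that pays for it.  Either way two roots are exchanged for two
  consecutive indices, and one continues with the quotient polynomial.  An index \<open>1\<close> that is left over
  at the end costs one root.
\<close>

lemma tail_even_cover_of_roots: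
  fixes Q :: "real poly" and x :: "nat \<Rightarrow> real"
  assumes "J \<subseteq> {1..N}"
    and "\<And>i j. i \<in> J \<Longrightarrow> j \<in> J \<Longrightarrow> i < j \<Longrightarrow> x j < x i"
    and "\<And>j. j \<in> J \<Longrightarrow> l < x j"
    and "Q \<noteq> 0"
    and "\<And>j. j \<in> J \<Longrightarrow> poly Q (x j) = 0"
    and "\<And>j. j \<in> J \<Longrightarrow> 2 \<le> j \<Longrightarrow> j - 1 \<notin> J \<Longrightarrow> 0 \<le> poly (pderiv Q) (x j)"
    and "0 \<le> poly Q l"
  shows "\<exists>J'. tail_even J' \<and> J \<subseteq> J' \<and> J' \<subseteq> {1..N} \<and> card J' \<le> degree Q"
  using assms
proof (induction N arbitrary: J Q l rule: less_induct)
  case (less N J Q l)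
  show ?case
  proof (cases "N \<in> J")
    case False
    show ?thesis
    proof (cases "N = 0")
      case True
      then show ?thesis using less.prems(1) tail_even_empty by (intro exI[of _ "{}"]) auto
    next
      case N: False
      have "J \<subseteq> {1..N - 1}"
      proof
        fix j assume "j \<in> J"
        then show "j \<in> {1..N - 1}" using less.prems(1) False by (cases "j = N") force+
      qed
      then have "\<exists>J'. tail_even J' \<and> J \<subseteq> J' \<and> J' \<subseteq> {1..N - 1} \<and> card J' \<le> degree Q"
        using less.prems N by (intro less.IH[of "N - 1" J l Q]) auto
      then show ?thesis by fastforce
    qed
  next
    case NJ: True
    show ?thesis
    proof (cases "N = 1")
      case True
      have "degree Q \<noteq> 0"
      proof
        assume "degree Q = 0"
        then obtain a where "Q = [:a:]" by (rule degree_eq_zeroE)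
        then show False using less.prems(4) less.prems(5)[OF NJ] by simp
      qed
      then show ?thesis using less.prems(1) True tail_even_one by (intro exI[of _ "{1}"]) auto
    next
      case False
      then have N: "2 \<le> N" using NJ less.prems(1) by force
      define J0 where "J0 = J - {N - 1, N}"
      have J0: "J0 \<subseteq> {1..N - 2}" using less.prems(1) N by (force simp: J0_def)
      \<comment> \<open>The two roots \<open>w\<close> and \<open>z\<close> to be divided out lie below all \<open>x j\<close> with \<open>j \<in> J0\<close>, so
      the quotient has the same slope signs there; \<open>m\<close> is the new left end.\<close>
      have "\<exists>z w m Q2. z \<le> x N \<and> (\<forall>j\<in>J0. w < x j) \<and> Q = [:-w, 1:] * ([:-z, 1:] * Q2) \<and>
          (\<forall>j\<in>J0. m < x j) \<and> 0 \<le> poly Q2 m"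
      proof (cases "N - 1 \<in> J")
        case True
        have lt: "x N < x (N - 1)" using less.prems(2)[OF True NJ] N by simp
        obtain Q1 where Q1: "Q = [:-x (N - 1), 1:] * Q1"
          using less.prems(5)[OF True] by (auto simp: poly_eq_0_iff_dvd dvd_def)
        have "poly Q1 (x N) = 0" using less.prems(5)[OF NJ] lt unfolding Q1 by simp
        then obtain Q2 where Q2: "Q1 = [:-x N, 1:] * Q2" by (auto simp: poly_eq_0_iff_dvd dvd_def)
        have "0 \<le> poly Q l" by (rule less.prems(7))
        also have "poly Q l = ((l - x (N - 1)) * (l - x N)) * poly Q2 l"
          unfolding Q1 Q2 by (simp add: algebra_simps)
        finally have "0 \<le> poly Q2 l"
          by (rule nonneg_of_mult_pos) (use less.prems(3)[OF NJ] less.prems(3)[OF True] in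
            \<open>simp add: mult_neg_neg\<close>)
        moreover have "x (N - 1) < x j" if "j \<in> J0" for j
          using that less.prems(2)[of j "N - 1"] True J0 N by (force simp: J0_def)
        ultimately show ?thesis using less.prems(3) Q1 Q2
          by (intro exI[of _ "x N"] exI[of _ "x (N - 1)"] exI[of _ l] exI[of _ Q2]) (auto simp: J0_def)
      next
        case nJ: False
        have "0 \<le> poly (pderiv Q) (x N)" using less.prems(6)[OF NJ N nJ] .
        then obtain z m Q2 where *: "l \<le> z" "z \<le> x N" "Q = [:-x N, 1:] * ([:-z, 1:] * Q2)"
          "m = l \<or> m = x N" "0 \<le> poly Q2 m"
          using split_double_root[OF less.prems(3)[OF NJ] less.prems(5)[OF NJ] less.prems(7)] by metis
        have "x N < x j" if "j \<in> J0" for j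
          using that less.prems(2)[of j N] NJ J0 N by (force simp: J0_def)
        then show ?thesis using * less.prems(3)
          by (intro exI[of _ z] exI[of _ "x N"] exI[of _ m] exI[of _ Q2]) (auto simp: J0_def)
      qed
      then obtain z w m Q2 where zw: "z \<le> x N" "\<And>j. j \<in> J0 \<Longrightarrow> w < x j"
        "Q = [:-w, 1:] * ([:-z, 1:] * Q2)" "\<And>j. j \<in> J0 \<Longrightarrow> m < x j" "0 \<le> poly Q2 m" by blast
      have zlt: "z < x j" if "j \<in> J0" for j
        using that less.prems(2)[of j N] NJ J0 N zw(1) by (force simp: J0_def)
      have Q20: "Q2 \<noteq> 0" using less.prems(4) zw(3) by auto
      have root: "poly Q2 (x j) = 0" if "j \<in> J0" for j
        using less.prems(5)[of j] that zw(2)[OF that] zlt[OF that] by (auto simp: J0_def zw(3))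
      have der: "0 \<le> poly (pderiv Q2) (x j)" if "j \<in> J0" "2 \<le> j" "j - 1 \<notin> J0" for j
      proof -
        have "j \<in> J" "j - 1 \<notin> J" using that J0 N by (auto simp: J0_def)
        then have "0 \<le> poly (pderiv Q) (x j)" using less.prems(6) that by blast
        also have "poly (pderiv Q) (x j) = ((x j - w) * (x j - z)) * poly (pderiv Q2) (x j)"
          unfolding zw(3) pderiv_mult using root[OF that(1)] by (simp add: pderiv_pCons algebra_simps)
        finally show ?thesis
          by (rule nonneg_of_mult_pos) (use zw(2)[OF that(1)] zlt[OF that(1)] in simp)
      qed
      have "\<exists>J'. tail_even J' \<and> J0 \<subseteq> J' \<and> J' \<subseteq> {1..N - 2} \<and> card J' \<le> degree Q2"
      proof (rule less.IH[of "N - 2" J0 m Q2])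
        show "x j < x i" if "i \<in> J0" "j \<in> J0" "i < j" for i j
          using that less.prems(2) by (auto simp: J0_def)
      qed (use J0 N zw root der Q20 in auto)
      then obtain J' where J': "tail_even J'" "J0 \<subseteq> J'" "J' \<subseteq> {1..N - 2}" "card J' \<le> degree Q2"
        by blast
      have "tail_even (insert (N - 1) (insert (Suc (N - 1)) J'))"
        using J'(1,3) N by (intro tail_even_insert_pair) force+
      moreover have "card (insert (N - 1) (insert (Suc (N - 1)) J')) \<le> card J' + 2"
        using tail_evenD(1)[OF J'(1)] by (simp add: card_insert_if)
      moreover have "degree Q = degree Q2 + 2"
      proof -
        have "[:-z, 1:] * Q2 \<noteq> 0" using less.prems(4) zw(3) by auto
        then show ?thesis using Q20 unfolding zw(3) by (simp add: degree_mult_eq del: mult_pCons_left)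
      qed
      moreover have "insert (N - 1) (insert (Suc (N - 1)) J') \<subseteq> {1..N}" using J'(3) N by force
      moreover have "J \<subseteq> insert (N - 1) (insert (Suc (N - 1)) J')"
        using J'(2) N by (auto simp: J0_def)
      ultimately show ?thesis using J'(4)
        by (intro exI[of _ "insert (N - 1) (insert (Suc (N - 1)) J')"]) linarith
    qed
  qed
qed

section \<open>The Kingman simplex and its power sums\<close>

definition mass_seq :: "(nat \<Rightarrow> real) set" where
  "mass_seq = {x. (\<forall>i. 0 \<le> x i) \<and> (\<forall>n. (\<Sum>i=1..n. x i) \<le> 1)}"

text \<open>
  The entries of interest are numbered from \<open>1\<close>.  The entry \<open>x 0 = 1\<close> is an upper bound for all of them and
  serves as a common starting point of any two sequences that are compared.
\<close>

definition kingman :: "(nat \<Rightarrow> real) set" where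
  "kingman = {x\<in>mass_seq. x 0 = 1 \<and> antimono x}"

definition psum :: "nat \<Rightarrow> (nat \<Rightarrow> real) \<Rightarrow> real" where
  "psum k x = (\<Sum>i. x (Suc i) ^ k)"

text \<open>
  These are the \<open>k\<close> for which \<open>(1/k, \<dots>, 1/k, 0, \<dots>)\<close>, with \<open>k\<close> nonzero entries, has a positive weight when \<open>x\<close> is
  written as a mixture of such sequences.
\<close>

definition jumps :: "(nat \<Rightarrow> real) \<Rightarrow> nat set" where
  "jumps x = {k. 1 \<le> k \<and> x (Suc k) < x k}"

lemma mass_seqD:
  assumes "x \<in> mass_seq"
  shows "0 \<le> x i" "(\<Sum>i=1..n. x i) \<le> 1"
  using assms by (auto simp: mass_seq_def)

lemma sum_Suc_shift: "(\<Sum>i<n. f (Suc i)) = (\<Sum>i=1..n. f i)" for f :: "nat \<Rightarrow> real"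
  by (rule sum.reindex_bij_witness[of _ "\<lambda>i. i - 1" Suc]) auto

lemma mass_seq_le_1:
  assumes "x \<in> mass_seq" "1 \<le> i"
  shows "x i \<le> 1"
proof -
  have "x i \<le> (\<Sum>i=1..i. x i)"
    using assms mass_seqD(1)[OF assms(1)] by (intro member_le_sum) auto
  also have "\<dots> \<le> 1" by (rule mass_seqD(2)[OF assms(1)])
  finally show ?thesis .
qed

lemma summable_mass_seq:
  assumes "x \<in> mass_seq" "1 \<le> k"
  shows "summable (\<lambda>i. x (Suc i) ^ k)"
proof (rule summable_comparison_test')
  show "summable (\<lambda>i. x (Suc i))"
    using mass_seqD[OF assms(1)]
    by (intro summableI_nonneg_bounded[where x = 1]) (auto simp: sum_Suc_shift)
  fix i
  show "norm (x (Suc i) ^ k) \<le> x (Suc i)" if "0 \<le> i"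
    using power_decreasing[OF assms(2), of "x (Suc i)"] mass_seqD(1)[OF assms(1)]
      mass_seq_le_1[OF assms(1)] by simp
qed

lemma psum_1_le:
  assumes "x \<in> mass_seq"
  shows "psum 1 x \<le> 1"
  unfolding psum_def
  by (rule suminf_le_const[OF summable_mass_seq[OF assms]])
    (use mass_seqD(2)[OF assms] in \<open>auto simp: sum_Suc_shift\<close>)

lemma mass_seqI:
  assumes "\<And>i. 0 \<le> x i" "summable (\<lambda>i. x (Suc i))" "psum 1 x \<le> 1"
  shows "x \<in> mass_seq"
proof -
  have "(\<Sum>i=1..n. x i) \<le> 1" for n
    using sum_le_suminf[OF assms(2), of "{..<n}"] assms by (simp add: sum_Suc_shift psum_def)
  then show ?thesis using assms(1) by (simp add: mass_seq_def)
qed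

lemma kingmanD:
  assumes "x \<in> kingman"
  shows "x \<in> mass_seq" "x 0 = 1" "antimono x" "0 \<le> x i" "i \<le> j \<Longrightarrow> x j \<le> x i"
  using assms by (auto simp: kingman_def mass_seqD dest: antimonoD)

lemma kingman_mult_le_1:
  assumes "x \<in> kingman"
  shows "real i * x i \<le> 1"
proof -
  have "real i * x i = (\<Sum>j=1..i. x i)" by simp
  also have "\<dots> \<le> (\<Sum>j=1..i. x j)" by (intro sum_mono kingmanD(5)[OF assms]) auto
  also have "\<dots> \<le> 1" by (rule mass_seqD(2)[OF kingmanD(1)[OF assms]])
  finally show ?thesis .
qed

lemma kingman_const:
  assumes "x \<in> kingman" "jumps x \<subseteq> J" "1 \<le> i" "i \<notin> J"
  shows "x i = x (Suc i)"
proof -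
  have "\<not> x (Suc i) < x i" using assms(2,3,4) by (auto simp: jumps_def)
  then show ?thesis using kingmanD(5)[OF assms(1), of i "Suc i"] by simp
qed

text \<open>
  A sequence that is eventually constant and satisfies \<open>i x\<^sub>i \<le> 1\<close> is eventually zero.
\<close>

lemma kingman_zero_beyond_jumps:
  assumes "x \<in> kingman" "jumps x \<subseteq> {..N}" "N < i"
  shows "x i = 0"
proof (rule ccontr)
  assume "x i \<noteq> 0"
  then have pos: "0 < x i" using kingmanD(4)[OF assms(1), of i] by simp
  have const: "x j = x i" if "i \<le> j" for j
    using that
  proof (induction j rule: dec_induct)
    case (step n)
    then show ?case using kingman_const[OF assms(1,2), of n] assms(3) by simp
  qed simp
  obtain n where n: "1 < real n * x i" using reals_Archimedean3[OF pos] by blast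
  define j where "j = max n i"
  have "real n * x i \<le> real j * x j"
    using const[of j] pos by (intro mult_mono) (auto simp: j_def)
  then show False using kingman_mult_le_1[OF assms(1), of j] n by simp
qed

section \<open>The limit set as a compact image\<close>

definition psum_vec :: "('m::finite \<Rightarrow> nat) \<Rightarrow> (nat \<Rightarrow> real) \<Rightarrow> real ^ 'm" where
  "psum_vec ix x = (\<chi> j. psum (ix j) x)"

lemma psum_finite:
  assumes "\<And>i. n < i \<Longrightarrow> x i = 0" "1 \<le> k"
  shows "(\<lambda>i. x (Suc i) ^ k) sums (\<Sum>i=1..n. x i ^ k)" "psum k x = (\<Sum>i=1..n. x i ^ k)"
proof -
  have "(\<lambda>i. x (Suc i) ^ k) sums (\<Sum>i<n. x (Suc i) ^ k)"
    using assms by (intro sums_finite) (auto simp: zero_power)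
  then show s: "(\<lambda>i. x (Suc i) ^ k) sums (\<Sum>i=1..n. x i ^ k)"
    by (simp only: sum_Suc_shift[of "\<lambda>i. x i ^ k"])
  show "psum k x = (\<Sum>i=1..n. x i ^ k)"
    unfolding psum_def using s by (rule sums_unique[symmetric])
qed

lemma full_simplex_mass_seq:
  assumes "x \<in> full_simplex n"
  shows "x \<in> mass_seq"
proof (rule mass_seqI)
  have z: "x i = 0" if "n < i" for i using assms that by (auto simp: full_simplex_def)
  show "0 \<le> x i" for i using assms by (cases "i \<in> {1..n}") (auto simp: full_simplex_def)
  show "summable (\<lambda>i. x (Suc i))" using psum_finite(1)[of n x 1] z by (auto simp: sums_iff)
  show "psum 1 x \<le> 1" using psum_finite(2)[of n x 1] z assms by (auto simp: full_simplex_def)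
qed

lemma full_simplex_psum_vec:
  assumes "x \<in> full_simplex n" "\<And>j. 1 \<le> ix j"
  shows "vandermonde_map ix n x = psum_vec ix x"
proof -
  have z: "x i = 0" if "n < i" for i using assms that by (auto simp: full_simplex_def)
  show ?thesis using psum_finite(2)[of n x] z assms(2)
    by (simp add: vandermonde_map_def psum_vec_def power_sum_def)
qed

text \<open>
  Power sums are symmetric, so the entries may be sorted.
\<close>

lemma prob_simplex_kingman:
  assumes "x \<in> prob_simplex n"
  obtains y where "y \<in> kingman" "\<And>k. 1 \<le> k \<Longrightarrow> psum k y = psum k x"
proof -
  define xs where "xs = map x [1..<Suc n]"
  define ys where "ys = rev (sort xs)"
  define y where "y i = (if i = 0 then 1 else if i \<le> n then ys ! (i - 1) else 0)" for i
  have len: "length ys = n" by (simp add: ys_def xs_def)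
  have z: "x i = 0" if "n < i" for i using assms that by (auto simp: prob_simplex_def)
  have yz: "y i = 0" if "n < i" for i using that by (simp add: y_def)
  have ps: "psum k y = psum k x" if k: "1 \<le> k" for k
  proof -
    have "psum k y = (\<Sum>i=1..n. y i ^ k)" using psum_finite(2)[of n y k] yz k by blast
    also have "\<dots> = (\<Sum>i<n. (ys ! i) ^ k)"
      by (rule sum.reindex_bij_witness[of _ Suc "\<lambda>i. i - 1"]) (auto simp: y_def)
    also have "\<dots> = sum_list (map (\<lambda>t. t ^ k) ys)"
      using len by (simp add: sum_list_sum_nth atLeast0LessThan)
    also have "\<dots> = sum_mset (image_mset (\<lambda>t. t ^ k) (mset ys))"
      by (metis mset_map sum_mset_sum_list)
    also have "\<dots> = sum_mset (image_mset (\<lambda>t. t ^ k) (mset xs))" by (simp add: ys_def)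
    also have "\<dots> = sum_list (map (\<lambda>t. t ^ k) xs)" by (metis mset_map sum_mset_sum_list)
    also have "\<dots> = (\<Sum>i\<leftarrow>[1..<Suc n]. x i ^ k)" by (simp add: xs_def comp_def)
    also have "\<dots> = (\<Sum>i=1..n. x i ^ k)"
      by (simp only: interv_sum_list_conv_sum_set_nat set_upt atLeastLessThanSuc_atLeastAtMost)
    also have "\<dots> = psum k x" using psum_finite(2)[of n x k] z k by simp
    finally show ?thesis .
  qed
  have xm: "x \<in> mass_seq" using assms
    by (intro full_simplex_mass_seq) (auto simp: full_simplex_def prob_simplex_def)
  have nn: "0 \<le> y i" for i
  proof (cases "1 \<le> i \<and> i \<le> n")
    case True
    then have "ys ! (i - 1) \<in> set ys" using len by (intro nth_mem) auto
    then show ?thesis using True mass_seqD(1)[OF xm] by (auto simp: y_def ys_def xs_def)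
  qed (auto simp: y_def)
  have "y \<in> mass_seq"
  proof (rule mass_seqI)
    show "summable (\<lambda>i. y (Suc i))" using psum_finite(1)[of n y 1] yz by (auto simp: sums_iff)
    show "psum 1 y \<le> 1" using ps[of 1] psum_1_le[OF xm] by simp
  qed (rule nn)
  moreover have "antimono y"
    unfolding decseq_Suc_iff
  proof
    fix i
    show "y (Suc i) \<le> y i"
    proof (cases "Suc i \<le> n \<and> i \<noteq> 0")
      case True
      have "sorted (rev ys)" by (simp add: ys_def)
      then have "ys ! i \<le> ys ! (i - 1)"
        using True len sorted_rev_nth_mono[of ys "i - 1" i] by simp
      then show ?thesis using True by (simp add: y_def)
    next
      case False
      then show ?thesis using nn[of i] mass_seq_le_1[OF \<open>y \<in> mass_seq\<close>, of "Suc i"]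
        by (cases "i = 0") (auto simp: y_def)
    qed
  qed
  moreover have "y 0 = 1" by (simp add: y_def)
  ultimately show ?thesis using that ps by (auto simp: kingman_def)
qed

text \<open>
  Cut the sequence after \<open>N\<close> entries and spread the missing mass evenly over \<open>N\<close> further entries.
  These contribute at most \<open>1/N\<close> to the power sums of exponent at least \<open>2\<close>.  No order of the entries is
  required, so perturbed sequences need not be sorted again.
\<close>

lemma psum_vec_in_Pi_limit:
  assumes x: "x \<in> mass_seq" and ix: "\<And>j. 2 \<le> ix j"
  shows "psum_vec ix x \<in> Pi_limit ix d"
proof -
  define r where "r N = 1 - (\<Sum>i=1..N. x i)" for N
  define z where "z N i = (if i = 0 then 0 else if i \<le> N then x i else if i \<le> 2 * N then r N / real N else 0)"
    for N i
  have r: "0 \<le> r N" "r N \<le> 1" for N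
    using mass_seqD(2)[OF x, of N] mass_seqD(1)[OF x] by (auto simp: r_def intro: sum_nonneg)
  have split: "(\<Sum>i=1..2*N. z N i ^ k) = (\<Sum>i=1..N. x i ^ k) + real N * (r N / real N) ^ k" for N k
  proof -
    have "{1..2*N} = {1..N} \<union> {N+1..2*N}" by auto
    then have "(\<Sum>i=1..2*N. z N i ^ k) = (\<Sum>i=1..N. z N i ^ k) + (\<Sum>i=N+1..2*N. z N i ^ k)"
      by (simp add: sum.union_disjoint)
    also have "(\<Sum>i=1..N. z N i ^ k) = (\<Sum>i=1..N. x i ^ k)" by (simp add: z_def)
    also have "(\<Sum>i=N+1..2*N. z N i ^ k) = (\<Sum>i=N+1..2*N. (r N / real N) ^ k)"
      by (intro sum.cong refl) (auto simp: z_def)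
    finally show ?thesis by simp
  qed
  have zs: "z N \<in> prob_simplex (2 * N)" if "1 \<le> N" for N
  proof -
    have "(\<Sum>i=1..2*N. z N i) = 1" using split[of N 1] that by (simp add: r_def)
    then show ?thesis using r[of N] mass_seqD(1)[OF x] by (auto simp: prob_simplex_def z_def)
  qed
  have lim: "(\<lambda>N. power_sum (2 * N) k (z N)) \<longlonglongrightarrow> psum k x" if k: "2 \<le> k" for k
  proof -
    have "(\<lambda>N. (\<Sum>i=1..N. x i ^ k)) \<longlonglongrightarrow> psum k x"
      using summable_LIMSEQ[OF summable_mass_seq[OF x, of k]] k
      by (simp add: psum_def sum_Suc_shift[of "\<lambda>i. x i ^ k"])
    moreover have "(\<lambda>N. real N * (r N / real N) ^ k) \<longlonglongrightarrow> 0"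
    proof (rule tendsto_sandwich[of "\<lambda>_. 0" _ _ "\<lambda>N. 1 / real N"])
      show "\<forall>\<^sub>F N in sequentially. real N * (r N / real N) ^ k \<le> 1 / real N"
        using eventually_ge_at_top[of 1]
      proof eventually_elim
        case (elim N)
        have "(r N / real N) ^ k \<le> (r N / real N) ^ 2"
          using r[of N] elim k by (intro power_decreasing) (auto simp: divide_simps)
        also have "\<dots> \<le> (1 / real N) ^ 2"
          using r[of N] by (intro power_mono divide_right_mono) auto
        finally have "real N * (r N / real N) ^ k \<le> real N * (1 / real N) ^ 2"
          by (intro mult_left_mono) auto
        then show ?case using elim by (simp add: power2_eq_square)
      qed
    qed (use r in \<open>auto intro: lim_1_over_n\<close>)
    ultimately have "(\<lambda>N. (\<Sum>i=1..N. x i ^ k) + real N * (r N / real N) ^ k) \<longlonglongrightarrow> psum k x + 0"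
      by (rule tendsto_add)
    then show ?thesis unfolding power_sum_def split by simp
  qed
  have tends: "(\<lambda>N. vandermonde_map ix (2 * N) (z N)) \<longlonglongrightarrow> psum_vec ix x"
    unfolding vandermonde_map_def psum_vec_def
    by (rule vec_tendstoI) (use lim[OF ix] in simp)
  have ev: "\<forall>\<^sub>F N in sequentially. vandermonde_map ix (2 * N) (z N) \<in> Pi_limit ix d"
    using eventually_ge_at_top[of "max 1 d"]
  proof eventually_elim
    case (elim N)
    then have "vandermonde_map ix (2 * N) (z N) \<in> Pi_set ix (2 * N)" "d \<le> 2 * N"
      using zs[of N] by (auto simp: Pi_set_def)
    then show ?case using closure_subset unfolding Pi_limit_def by fastforce
  qed
  have "closed (Pi_limit ix d)" unfolding Pi_limit_def by (rule closed_closure)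
  then show ?thesis by (rule Lim_in_closed_set[OF _ ev sequentially_bot tends])
qed

lemma Pi_tilde_subset_Pi_limit:
  assumes "\<And>j. 2 \<le> ix j"
  shows "Pi_tilde_set ix n \<subseteq> Pi_limit ix d"
proof -
  have ix1: "1 \<le> ix j" for j using assms[of j] by simp
  have "vandermonde_map ix n x \<in> Pi_limit ix d" if "x \<in> full_simplex n" for x
    unfolding full_simplex_psum_vec[OF that ix1]
    by (rule psum_vec_in_Pi_limit[OF full_simplex_mass_seq[OF that] assms])
  then show ?thesis unfolding Pi_tilde_set_def by blast
qed

text \<open>
  The series of \<open>k\<close>-th powers converges uniformly, because \<open>x\<^sub>i \<le> 1/i\<close>.  For \<open>k = 1\<close> this fails: mass can
  escape to infinity.
\<close>

lemma continuous_on_psum: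
  assumes "2 \<le> k"
  shows "continuous_on kingman (psum k)"
proof -
  have "uniform_limit kingman (\<lambda>n x. \<Sum>i<n. x (Suc i) ^ k) (\<lambda>x. \<Sum>i. x (Suc i) ^ k) sequentially"
  proof (rule Weierstrass_m_test)
    fix n x assume x: "x \<in> kingman"
    have le: "x (Suc n) \<le> 1 / real (Suc n)"
      using kingman_mult_le_1[OF x, of "Suc n"] by (simp add: divide_simps mult.commute)
    have nn: "0 \<le> x (Suc n)" by (rule kingmanD(4)[OF x])
    have "x (Suc n) ^ k \<le> x (Suc n) ^ 2"
      using nn mass_seq_le_1[OF kingmanD(1)[OF x]] assms by (intro power_decreasing) auto
    also have "\<dots> \<le> (1 / real (Suc n)) ^ 2" using nn le by (intro power_mono) auto
    finally show "norm (x (Suc n) ^ k) \<le> inverse (real (Suc n) ^ 2)"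
      using nn by (simp add: divide_simps)
  next
    show "summable (\<lambda>n. inverse (real (Suc n) ^ 2))"
      using inverse_power_summable[of 2, where 'a = real] by (subst summable_Suc_iff) simp
  qed
  moreover have "continuous_on kingman (\<lambda>x. \<Sum>i<n. x (Suc i) ^ k)" for n
    by (intro continuous_on_sum continuous_on_power continuous_on_subset[OF continuous_on_product_coordinates])
      simp
  ultimately have "continuous_on kingman (\<lambda>x. \<Sum>i. x (Suc i) ^ k)"
    by (intro uniform_limit_theorem[where F = sequentially]) auto
  then show ?thesis by (simp add: psum_def[abs_def])
qed

lemma compact_kingman: "compact kingman"
proof -
  have "kingman = {x. x 0 = 1} \<inter> (\<Inter>i. {x. 0 \<le> x i}) \<inter> (\<Inter>n. {x. (\<Sum>i=1..n. x i) \<le> 1}) \<inter>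
      (\<Inter>i. {x. x (Suc i) \<le> x i})"
    by (auto simp: kingman_def mass_seq_def decseq_Suc_iff)
  also have "closed \<dots>"
    by (intro closed_Int closed_INT ballI closed_Collect_eq closed_Collect_le continuous_on_sum
        continuous_on_const continuous_on_product_coordinates)
  finally have "closed kingman" .
  moreover have "compact (PiE UNIV (\<lambda>_::nat. {0..1::real}))"
    using compactin_PiE[of "\<lambda>_::nat. euclidean :: real topology" UNIV "\<lambda>_. {0..1}"]
    by (simp add: euclidean_product_topology)
  moreover have "kingman \<subseteq> PiE UNIV (\<lambda>_::nat. {0..1::real})"
  proof
    fix x assume x: "x \<in> kingman"
    have "0 \<le> x i \<and> x i \<le> 1" for i
      using kingmanD(4)[OF x, of i] kingmanD(5)[OF x, of 0 i] kingmanD(2)[OF x] by simp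
    then show "x \<in> PiE UNIV (\<lambda>_::nat. {0..1::real})" by (simp add: PiE_def Pi_def)
  qed
  ultimately show ?thesis by (metis compact_Int_closed Int_absorb1)
qed

lemma continuous_on_psum_vec:
  assumes "\<And>j. 2 \<le> ix j"
  shows "continuous_on kingman (psum_vec ix)"
  unfolding psum_vec_def[abs_def]
  by (intro continuous_on_vec_lambda continuous_on_psum assms)

lemma Pi_limit_eq:
  assumes ix: "\<And>j. 2 \<le> ix j"
  shows "Pi_limit ix d = psum_vec ix ` kingman"
proof
  have "Pi_set ix n \<subseteq> psum_vec ix ` kingman" for n
  proof
    fix p assume "p \<in> Pi_set ix n"
    then obtain x where x: "x \<in> prob_simplex n" "p = vandermonde_map ix n x"
      by (auto simp: Pi_set_def)
    have ix1: "1 \<le> ix j" for j using ix[of j] by simp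
    obtain y where y: "y \<in> kingman" "\<And>k. 1 \<le> k \<Longrightarrow> psum k y = psum k x"
      using prob_simplex_kingman[OF x(1)] by blast
    have "x \<in> full_simplex n" using x(1) by (auto simp: prob_simplex_def full_simplex_def)
    then have "p = psum_vec ix y" using full_simplex_psum_vec[of x n ix] ix1 x(2) y(2)
      by (simp add: psum_vec_def)
    then show "p \<in> psum_vec ix ` kingman" using y(1) by blast
  qed
  moreover have "closed (psum_vec ix ` kingman)"
    by (intro compact_imp_closed compact_continuous_image continuous_on_psum_vec compact_kingman ix)
  ultimately show "Pi_limit ix d \<subseteq> psum_vec ix ` kingman"
    unfolding Pi_limit_def by (intro closure_minimal UN_least)
  show "psum_vec ix ` kingman \<subseteq> Pi_limit ix d"
    by (intro image_subsetI psum_vec_in_Pi_limit kingmanD(1) ix)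
qed

section \<open>Sequences with Gale support are extremal\<close>

text \<open>
  An antiderivative of such a polynomial is at least as large at \<open>a\<close> as at \<open>b\<close>, whatever the order of \<open>a\<close> and \<open>b\<close>.
\<close>

definition fits_gap :: "real poly \<Rightarrow> real \<Rightarrow> real \<Rightarrow> bool" where
  "fits_gap P a b \<longleftrightarrow>
    (\<forall>t. b < t \<longrightarrow> t < a \<longrightarrow> 0 \<le> poly P t) \<and> (\<forall>t. a < t \<longrightarrow> t < b \<longrightarrow> poly P t \<le> 0)"

text \<open>
  Let \<open>N\<^sub>x(t)\<close> be the number of entries of \<open>x\<close> above \<open>t\<close>.  The polynomial must have the sign of the
  difference \<open>N\<^sub>x - N\<^sub>y\<close>.  As \<open>t\<close> decreases, this difference can only fall where \<open>N\<^sub>x\<close> is constant, and it rises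
  only at the drops of \<open>x\<close>; a rise by one cannot lead from negative to positive values.  Hence a pair \<open>k, k + 1\<close>
  of drops permits just one passage from negative to positive and one back, and two roots
  \<open>u \<ge> v\<close> suffice for it.  The inequality below the last compared entry is what lets the induction continue: there,
  the polynomial has the sign required once \<open>x\<close> has run out.
\<close>

lemma tail_even_sign_poly:
  fixes x y :: "nat \<Rightarrow> real"
  assumes "tail_even J"
    and anti: "antimono x" "antimono y"
    and start: "x 0 = y 0"
    and nonneg: "\<And>i. 0 \<le> x i" "\<And>i. 0 \<le> y i"
    and const: "\<And>i. 1 \<le> i \<Longrightarrow> i < Max (insert 0 J) \<Longrightarrow> i \<notin> J \<Longrightarrow> x i = x (Suc i)"
  shows "\<exists>P. degree P = card J \<and> lead_coeff P = (-1) ^ (card J + 1) \<and>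
    (\<forall>i\<le>Max (insert 0 J). fits_gap P (x i) (y i)) \<and>
    (\<forall>t. 0 \<le> t \<longrightarrow> t \<le> y (Max (insert 0 J)) \<longrightarrow> poly P t \<le> 0)"
  using assms(1) const
proof (induction rule: tail_even_induct)
  case empty
  show ?case using start by (intro exI[of _ "[:-1:]"]) (auto simp: fits_gap_def)
next
  case one
  show ?case using start
    by (intro exI[of _ "[:- y 1, 1:]"]) (auto simp: fits_gap_def le_Suc_eq)
next
  case (pair J k)
  define M where "M = Max (insert 0 J)"
  note J = tail_evenD[OF pair(1)]
  have Mk: "M < k" using pair(2,3) J(1) by (simp add: M_def)
  have Max: "Max (insert 0 (insert k (insert (Suc k) J))) = Suc k"
    by (rule Max_eqI) (use J(1) pair(2) in force)+
  have M_ge: "j \<le> M" if "j \<in> J" for j using that J(1) by (simp add: M_def)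
  have "\<exists>P. degree P = card J \<and> lead_coeff P = (- 1) ^ (card J + 1) \<and>
      (\<forall>i\<le>Max (insert 0 J). fits_gap P (x i) (y i)) \<and>
      (\<forall>t. 0 \<le> t \<longrightarrow> t \<le> y (Max (insert 0 J)) \<longrightarrow> poly P t \<le> 0)"
  proof (rule pair(4))
    fix i assume "1 \<le> i" "i < Max (insert 0 J)" "i \<notin> J"
    then show "x i = x (Suc i)" using pair(5)[of i] Mk Max by (simp add: M_def)
  qed
  then obtain P where P: "degree P = card J" "lead_coeff P = (- 1) ^ (card J + 1)"
    "\<And>i. i \<le> M \<Longrightarrow> fits_gap P (x i) (y i)"
    "\<And>t. 0 \<le> t \<Longrightarrow> t \<le> y M \<Longrightarrow> poly P t \<le> 0" unfolding M_def by blast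
  have xk: "x i = x k" if "M < i" "i \<le> k" for i
    using that(2,1)
  proof (induction i rule: inc_induct)
    case (step n)
    have "n \<notin> J" using M_ge[of n] step by auto
    then show ?case using pair(5)[of n] step Max by simp
  qed simp
  have mono: "x j \<le> x i" "y j \<le> y i" if "i \<le> j" for i j
    using anti that by (auto dest: antimonoD)
  \<comment> \<open>The interval between \<open>v\<close> and \<open>u\<close> is where the old polynomial is not positive but the
  two new drops require a positive sign.  If there is no such place, a double root
  \<open>u = v\<close> leaves all signs as they are.\<close>
  have "\<exists>u v. v = y (Suc k) \<and> v \<le> u \<and> u \<le> x k \<and> u \<le> y M \<and>
      (y k < x k \<longrightarrow> x k \<le> u \<or> u = y M) \<and> (v < x (Suc k) \<longrightarrow> x (Suc k) \<le> u \<or> u = y M) \<or>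
      u = v \<and> x k \<le> y k \<and> x (Suc k) \<le> y (Suc k)"
  proof (cases "y k < x k")
    case True
    then show ?thesis using mono(1)[of k "Suc k"] mono(2)[of k "Suc k"] mono(2)[of M "Suc k"] Mk
      by (intro exI[of _ "min (x k) (y M)"] exI[of _ "y (Suc k)"]) (auto simp: min_def)
  next
    case False
    then show ?thesis using mono(1)[of k "Suc k"] mono(2)[of M k] Mk
      by (cases "y (Suc k) < x (Suc k)")
        (rule exI[of _ "x (Suc k)"], rule exI[of _ "y (Suc k)"], force, force)
  qed
  then obtain u v where uv: "v = y (Suc k) \<and> v \<le> u \<and> u \<le> x k \<and> u \<le> y M \<and>
      (y k < x k \<longrightarrow> x k \<le> u \<or> u = y M) \<and> (v < x (Suc k) \<longrightarrow> x (Suc k) \<le> u \<or> u = y M) \<or>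
      u = v \<and> x k \<le> y k \<and> x (Suc k) \<le> y (Suc k)" by blast
  define Q where "Q = [:-u, 1:] * ([:-v, 1:] * P)"
  have Q: "poly Q t = ((t - u) * (t - v)) * poly P t" for t
    by (simp add: Q_def algebra_simps)
  have P0: "P \<noteq> 0" using P(2) by auto
  have cd: "card (insert k (insert (Suc k) J)) = card J + 2"
    using J(1) pair(2)[of k] pair(2)[of "Suc k"] by (simp add: card_insert_if) blast
  have vP0: "[:-v, 1:] * P \<noteq> 0" using P0 by (simp del: mult_pCons_left)
  have deg: "degree Q = card J + 2"
    unfolding Q_def using P0 P(1) vP0 by (simp add: degree_mult_eq del: mult_pCons_left)
  have lead: "lead_coeff Q = (-1) ^ (card J + 2 + 1)"
    unfolding Q_def lead_coeff_mult P(2) by simp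
  have outer: "0 \<le> (t - u) * (t - v)" if "x k \<le> t \<or> y M \<le> t \<or> t \<le> y (Suc k)" for t
    using uv that by (smt (verit) mult_nonneg_nonneg mult_nonpos_nonpos zero_le_square)
  have inner: "0 \<le> poly Q t"
    if "y (Suc k) < t" "t < s" "s \<le> x k" "s \<le> u \<or> u = y M" "v = y (Suc k)" for t s
  proof (cases "t \<le> u")
    case True
    have "(t - u) * (t - v) \<le> 0" using True that by (simp add: mult_le_0_iff)
    moreover have "poly P t \<le> 0" using True P(4)[of t] that uv nonneg(2)[of "Suc k"] by smt
    ultimately show ?thesis unfolding Q by (rule mult_nonpos_nonpos)
  next
    case False
    then have "u = y M" using that by auto
    then have "0 \<le> poly P t"
      using P(3)[of M] False that mono(1)[of M k] Mk by (auto simp: fits_gap_def)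
    moreover have "0 \<le> (t - u) * (t - v)" using False \<open>u = y M\<close> outer by auto
    ultimately show ?thesis unfolding Q by simp
  qed
  have low: "poly Q t \<le> 0" if "0 \<le> t" "t \<le> y (Suc k)" for t
    using outer[of t] P(4)[of t] that mono(2)[of M "Suc k"] Mk unfolding Q
    by (intro mult_nonneg_nonpos) auto
  have "fits_gap Q (x i) (y i)" if i: "i \<le> Suc k" for i
  proof -
    consider "i \<le> M" | "M < i" "i \<le> k" | "i = Suc k" using i by linarith
    then show ?thesis
    proof cases
      case 1
      have "0 \<le> (t - u) * (t - v)" if "min (x i) (y i) < t" for t
        using outer[of t] that mono(1)[of i k] mono(2)[of i M] 1 Mk by (auto simp: min_less_iff_disj)
      then show ?thesis using P(3)[OF 1] unfolding fits_gap_def Q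
        by (auto intro: mult_nonneg_nonneg mult_nonneg_nonpos)
    next
      case 2
      have "0 \<le> poly Q t" if "y i < t" "t < x i" for t
        using inner[of t "x k"] that xk[OF 2] mono(2)[of i k] mono(2)[of k "Suc k"] 2 uv by force
      moreover have "poly Q t \<le> 0" if "x i < t" "t < y i" for t
      proof -
        have "0 \<le> t" using that(1) nonneg(1)[of i] by simp
        then show ?thesis
          using outer[of t] P(4)[of t] that xk[OF 2] mono(2)[of M i] 2 unfolding Q
          by (intro mult_nonneg_nonpos) auto
      qed
      ultimately show ?thesis by (auto simp: fits_gap_def)
    next
      case 3
      have "0 \<le> poly Q t" if "y i < t" "t < x i" for t
        using inner[of t "x (Suc k)"] that mono(1)[of k "Suc k"] 3 uv by force
      moreover have "poly Q t \<le> 0" if "x i < t" "t < y i" for t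
        using low[of t] that 3 nonneg(1)[of i] by simp
      ultimately show ?thesis by (auto simp: fits_gap_def)
    qed
  qed
  then show ?case using deg lead low unfolding Max cd by (intro exI[of _ Q]) auto
qed

definition antideriv :: "real poly \<Rightarrow> real \<Rightarrow> real" where
  "antideriv P t = (\<Sum>k\<le>degree P. coeff P k / real (Suc k) * t ^ Suc k)"

lemma DERIV_antideriv: "DERIV (antideriv P) t :> poly P t"
proof -
  have "((\<lambda>t. \<Sum>k\<le>degree P. coeff P k / real (Suc k) * t ^ Suc k) has_real_derivative
      (\<Sum>k\<le>degree P. coeff P k * t ^ k)) (at t)"
  proof (rule DERIV_sum)
    fix k
    show "((\<lambda>t. coeff P k / real (Suc k) * t ^ Suc k) has_real_derivative coeff P k * t ^ k) (at t)"
      using DERIV_cmult[OF DERIV_pow[of "Suc k" t], of "coeff P k / real (Suc k)"]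
      by (simp del: of_nat_Suc power_Suc)
  qed
  then show ?thesis unfolding antideriv_def[abs_def] poly_altdef .
qed

lemma fits_gap_antideriv:
  assumes "fits_gap P a b"
  shows "antideriv P b \<le> antideriv P a"
proof -
  have cont: "continuous_on S (antideriv P)" for S
    using DERIV_antideriv by (meson DERIV_isCont continuous_at_imp_continuous_on)
  consider "b < a" | "a < b" | "a = b" by linarith
  then show ?thesis
  proof cases
    case 1
    then show ?thesis
      using assms DERIV_antideriv cont unfolding fits_gap_def
      by (intro DERIV_nonneg_imp_increasing_open[of b a "antideriv P"]) auto
  next
    case 2
    then show ?thesis
      using assms DERIV_antideriv cont unfolding fits_gap_def
      by (intro DERIV_nonpos_imp_decreasing_open[of a b "antideriv P"]) auto
  qed simp
qed

text \<open>
  Sum the increments of the antiderivative between \<open>y\<^sub>i\<close> and \<open>x\<^sub>i\<close> over all \<open>i\<close>.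
\<close>

lemma fits_gap_psum:
  assumes "x \<in> mass_seq" "y \<in> mass_seq" "\<And>i. 1 \<le> i \<Longrightarrow> fits_gap P (x i) (y i)"
  shows "0 \<le> (\<Sum>k\<le>degree P. coeff P k / real (Suc k) * (psum (Suc k) x - psum (Suc k) y))"
proof -
  have sm: "summable (\<lambda>i. coeff P k / real (Suc k) * (x (Suc i) ^ Suc k - y (Suc i) ^ Suc k))" for k
    using assms by (intro summable_mult summable_diff summable_mass_seq) auto
  have "0 \<le> (\<Sum>i. antideriv P (x (Suc i)) - antideriv P (y (Suc i)))"
  proof (rule suminf_nonneg)
    show "summable (\<lambda>i. antideriv P (x (Suc i)) - antideriv P (y (Suc i)))"
      unfolding antideriv_def sum_subtractf[symmetric] right_diff_distrib[symmetric]
      by (intro summable_sum sm)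
  qed (use fits_gap_antideriv assms(3) in auto)
  also have "\<dots> = (\<Sum>i. \<Sum>k\<le>degree P. coeff P k / real (Suc k) * (x (Suc i) ^ Suc k - y (Suc i) ^ Suc k))"
    unfolding antideriv_def sum_subtractf[symmetric] right_diff_distrib[symmetric] ..
  also have "\<dots> = (\<Sum>k\<le>degree P. \<Sum>i. coeff P k / real (Suc k) * (x (Suc i) ^ Suc k - y (Suc i) ^ Suc k))"
    by (rule suminf_sum[OF sm])
  also have "\<dots> = (\<Sum>k\<le>degree P. coeff P k / real (Suc k) * (psum (Suc k) x - psum (Suc k) y))"
  proof (intro sum.cong refl)
    fix k
    have s: "summable (\<lambda>i. x (Suc i) ^ Suc k)" "summable (\<lambda>i. y (Suc i) ^ Suc k)"
      using assms by (auto intro!: summable_mass_seq simp del: power_Suc)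
    show "(\<Sum>i. coeff P k / real (Suc k) * (x (Suc i) ^ Suc k - y (Suc i) ^ Suc k)) =
        coeff P k / real (Suc k) * (psum (Suc k) x - psum (Suc k) y)"
      unfolding psum_def suminf_diff[OF s] by (rule suminf_mult[OF summable_diff[OF s]])
  qed
  finally show ?thesis .
qed

lemma nonneg_of_divide_nat: "0 \<le> a / real d \<Longrightarrow> 0 < d \<Longrightarrow> 0 \<le> a"
  by (simp add: zero_le_divide_iff)

text \<open>
  In the inequality for the sign polynomial \<open>P\<close> all terms with exponents \<open>2, \<dots>, d - 1\<close> cancel.  If
  \<open>card J = d - 1\<close>, there remains a term with \<open>p\<^sub>1\<close>; it has a favourable sign because \<open>P(0) \<le> 0\<close> and
  \<open>p\<^sub>1(y) \<le> 1 = p\<^sub>1(x)\<close>.  If \<open>card J = d - 2\<close>, the sums of \<open>x\<close> and \<open>y\<close> are not related, and \<open>t P(t)\<close> is used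
  instead, whose antiderivative has no linear term.
\<close>

lemma kingman_extremal:
  assumes "tail_even J" "card J = d - 1 \<and> psum 1 x = 1 \<or> card J = d - 2" "2 \<le> d"
    and x: "x \<in> kingman" and jx: "jumps x \<subseteq> J" and y: "y \<in> kingman"
    and eq: "\<And>k. 2 \<le> k \<Longrightarrow> k < d \<Longrightarrow> psum k x = psum k y"
  shows "0 \<le> (-1) ^ (card J + 1) * (psum d x - psum d y)"
proof -
  define M where "M = Max (insert 0 J)"
  note J = tail_evenD[OF assms(1)]
  have JM: "J \<subseteq> {..M}" using J(1) by (auto simp: M_def)
  have "\<exists>P. degree P = card J \<and> lead_coeff P = (-1) ^ (card J + 1) \<and>
    (\<forall>i\<le>M. fits_gap P (x i) (y i)) \<and> (\<forall>t. 0 \<le> t \<longrightarrow> t \<le> y M \<longrightarrow> poly P t \<le> 0)"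
    unfolding M_def
    by (rule tail_even_sign_poly) (use assms(1) kingmanD[OF x] kingmanD[OF y] kingman_const[OF x jx] in auto)
  then obtain P where P: "degree P = card J" "lead_coeff P = (-1) ^ (card J + 1)"
    "\<And>i. i \<le> M \<Longrightarrow> fits_gap P (x i) (y i)"
    "\<And>t. 0 \<le> t \<Longrightarrow> t \<le> y M \<Longrightarrow> poly P t \<le> 0" by blast
  have gap: "fits_gap P (x i) (y i)" for i
  proof (cases "i \<le> M")
    case False
    have "jumps x \<subseteq> {..M}" using jx JM by blast
    then have "x i = 0" using kingman_zero_beyond_jumps[OF x] False by simp
    then show ?thesis using P(4) kingmanD(5)[OF y, of M i] kingmanD(4)[OF y, of i] False
      by (auto simp: fits_gap_def)
  qed (rule P(3))
  have P0: "P \<noteq> 0" using P(2) by auto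
  have xy: "x \<in> mass_seq" "y \<in> mass_seq" using kingmanD x y by auto
  consider "card J = d - 1" "psum 1 x = 1" | "card J = d - 2" using assms(2) by blast
  then show ?thesis
  proof cases
    case 1
    define f where "f k = coeff P k / real (Suc k) * (psum (Suc k) x - psum (Suc k) y)" for k
    have "0 \<le> (\<Sum>k\<le>d - 1. f k)"
      using fits_gap_psum[OF xy gap] P(1) 1 unfolding f_def by simp
    also have "\<dots> = (\<Sum>k\<in>{0, d - 1}. f k)"
    proof (rule sum.mono_neutral_right)
      show "\<forall>k\<in>{..d - 1} - {0, d - 1}. f k = 0"
      proof
        fix k assume "k \<in> {..d - 1} - {0, d - 1}"
        then have "psum (Suc k) x = psum (Suc k) y" by (intro eq) auto
        then show "f k = 0" by (simp add: f_def)
      qed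
    qed auto
    also have "\<dots> = f 0 + f (d - 1)" using assms(3) by simp
    finally have "0 \<le> f 0 + f (d - 1)" .
    moreover have "f 0 \<le> 0"
    proof -
      have "coeff P 0 \<le> 0" using P(4)[of 0] kingmanD(4)[OF y] by (simp add: poly_0_coeff_0)
      moreover have "0 \<le> psum 1 x - psum 1 y" using 1 psum_1_le[OF xy(2)] by simp
      ultimately show ?thesis by (simp add: f_def mult_nonpos_nonneg)
    qed
    moreover have "f (d - 1) = ((-1) ^ (card J + 1) * (psum d x - psum d y)) / real d"
      using P(1,2) 1 assms(3) by (simp add: f_def)
    ultimately have "0 \<le> ((-1) ^ (card J + 1) * (psum d x - psum d y)) / real d" by linarith
    then show ?thesis by (rule nonneg_of_divide_nat) (use assms(3) in simp)
  next
    case 2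
    define P1 where "P1 = pCons 0 P"
    have P1: "poly P1 t = t * poly P t" for t by (simp add: P1_def)
    have gap1: "fits_gap P1 (x i) (y i)" for i
      using gap[of i] kingmanD(4)[OF x, of i] kingmanD(4)[OF y, of i]
      unfolding fits_gap_def P1 by (auto intro!: mult_nonneg_nonneg mult_nonneg_nonpos)
    have deg: "degree P1 = d - 1" using P0 P(1) 2 assms(3) by (simp add: P1_def degree_pCons_eq)
    define f where "f k = coeff P1 k / real (Suc k) * (psum (Suc k) x - psum (Suc k) y)" for k
    have "0 \<le> (\<Sum>k\<le>d - 1. f k)"
      using fits_gap_psum[OF xy gap1] deg unfolding f_def by simp
    also have "\<dots> = (\<Sum>k\<in>{d - 1}. f k)"
    proof (rule sum.mono_neutral_right)
      show "\<forall>k\<in>{..d - 1} - {d - 1}. f k = 0"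
      proof
        fix k assume k: "k \<in> {..d - 1} - {d - 1}"
        show "f k = 0"
        proof (cases "k = 0")
          case False
          then have "psum (Suc k) x = psum (Suc k) y" using k by (intro eq) auto
          then show "f k = 0" by (simp add: f_def)
        qed (simp add: f_def P1_def)
      qed
    qed auto
    also have "\<dots> = f (d - 1)" by simp
    also have "f (d - 1) = ((-1) ^ (card J + 1) * (psum d x - psum d y)) / real d"
    proof -
      have "coeff P1 (d - 1) = (-1) ^ (card J + 1)"
        using P(2) P0 unfolding deg[symmetric] by (simp add: P1_def)
      then show ?thesis using assms(3) by (simp add: f_def)
    qed
    finally show ?thesis by (rule nonneg_of_divide_nat) (use assms(3) in simp)
  qed
qed

text \<open>
  The sequences that parametrise the Gale patches; the size \<open>d - 2\<close> occurs for \<open>0 \<in> R\<close>, where the sum of \<open>x\<close> is not prescribed.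
\<close>

definition gale_seqs :: "nat \<Rightarrow> (nat \<Rightarrow> real) set" where
  "gale_seqs d = {x\<in>kingman. \<exists>J. tail_even J \<and> jumps x \<subseteq> J \<and>
    (card J = d - 1 \<and> psum 1 x = 1 \<or> card J = d - 2)}"

text \<open>
  By extremality, the points directly above or directly below \<open>\<nu>(x)\<close> in the direction of \<open>p\<^sub>d\<close> are not attained.
\<close>

lemma gale_seqs_frontier:
  fixes ix :: "'m::finite \<Rightarrow> nat"
  assumes d: "2 \<le> d" and ix: "bij_betw ix UNIV {2..d}" and x: "x \<in> gale_seqs d"
  shows "psum_vec ix x \<in> frontier (Pi_limit ix d)"
proof -
  have ix2: "2 \<le> ix j" "ix j \<le> d" for j using bij_betw_apply[OF ix, of j] by auto
  have ex: "\<exists>j. ix j = k" if "2 \<le> k" "k \<le> d" for k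
    using ix that unfolding bij_betw_def by (metis atLeastAtMost_iff image_iff)
  obtain j0 where j0: "ix j0 = d" using ex[of d] d by blast
  have xK: "x \<in> kingman" using x by (simp add: gale_seqs_def)
  obtain J where J: "tail_even J" "jumps x \<subseteq> J" "card J = d - 1 \<and> psum 1 x = 1 \<or> card J = d - 2"
    using x by (auto simp: gale_seqs_def)
  define \<sigma> :: real where "\<sigma> = (-1) ^ (card J + 1)"
  have \<sigma>: "\<sigma> * \<sigma> = 1" "\<bar>\<sigma>\<bar> = 1" by (simp_all add: \<sigma>_def flip: power_mult_distrib)
  have "psum_vec ix x \<notin> interior (Pi_limit ix d)"
  proof
    assume "psum_vec ix x \<in> interior (Pi_limit ix d)"
    then obtain e where e: "0 < e" "ball (psum_vec ix x) e \<subseteq> Pi_limit ix d"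
      by (auto simp: mem_interior)
    \<comment> \<open>The sign \<open>\<sigma>\<close> makes \<open>q\<close> lie on the side that \<open>kingman_extremal\<close> excludes.\<close>
    define q where "q = psum_vec ix x + (\<sigma> * (e / 2)) *\<^sub>R axis j0 1"
    have "norm ((\<sigma> * (e / 2)) *\<^sub>R (axis j0 1 :: real ^ 'm)) = e / 2"
      using e(1) \<sigma>(2) by (simp add: norm_axis_1 abs_mult)
    then have "dist (psum_vec ix x) q = e / 2" by (simp add: q_def dist_norm)
    then have "q \<in> ball (psum_vec ix x) e" using e(1) by simp
    then have "q \<in> psum_vec ix ` kingman" using e(2) Pi_limit_eq[of ix d] ix2(1) by blast
    then obtain y where y: "y \<in> kingman" "q = psum_vec ix y" by blast
    have qj: "psum (ix j) y = psum (ix j) x + (if j = j0 then \<sigma> * (e / 2) else 0)" for j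
    proof -
      have "q $ j = psum (ix j) y" using y(2) by (simp add: psum_vec_def)
      then show ?thesis by (cases "j = j0") (simp_all add: q_def psum_vec_def axis_def)
    qed
    have "0 \<le> \<sigma> * (psum d x - psum d y)"
      unfolding \<sigma>_def
    proof (rule kingman_extremal[OF J(1) J(3) d xK J(2) y(1)])
      fix k assume k: "2 \<le> k" "k < d"
      then obtain j where j: "ix j = k" using ex[of k] by auto
      have "j \<noteq> j0" using j j0 k(2) by auto
      then show "psum k x = psum k y" using qj[of j] j by simp
    qed
    also have "\<sigma> * (psum d x - psum d y) = - (\<sigma> * \<sigma>) * (e / 2)" using qj[of j0] j0 by simp
    finally show False using \<sigma>(1) e(1) by simp
  qed
  moreover have "psum_vec ix x \<in> Pi_limit ix d"
    by (intro psum_vec_in_Pi_limit kingmanD(1) xK ix2)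
  ultimately show ?thesis using closure_subset by (auto simp: frontier_def)
qed

section \<open>The Gale part is closed\<close>

text \<open>
  A drop of the limit is a drop of almost all members of the sequence, so the index sets of the members eventually contain all drops
  of the limit.  The only problem is a loss of mass: all members have sum \<open>1\<close> but the limit does not.
  Then the largest indices tend to infinity, and the last pair of a member can be replaced by a
  single index, which brings the size down from \<open>d - 1\<close> to \<open>d - 2\<close>.
\<close>

lemma gale_seqs_limit:
  assumes d: "3 \<le> d" and f: "\<And>n. f n \<in> gale_seqs d" and x: "x \<in> kingman"
    and lim: "\<And>i. (\<lambda>n. f n i) \<longlonglongrightarrow> x i"
  shows "x \<in> gale_seqs d"
proof -
  have fK: "f n \<in> kingman" for n using f[of n] by (simp add: gale_seqs_def)
  have "\<exists>J. \<forall>n. tail_even (J n) \<and> jumps (f n) \<subseteq> J n \<and>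
    (card (J n) = d - 1 \<and> psum 1 (f n) = 1 \<or> card (J n) = d - 2)"
    using f unfolding gale_seqs_def by (intro choice) blast
  then obtain J where J: "\<And>n. tail_even (J n)" "\<And>n. jumps (f n) \<subseteq> J n"
    "\<And>n. card (J n) = d - 1 \<and> psum 1 (f n) = 1 \<or> card (J n) = d - 2" by blast
  note fin = tail_evenD(1)[OF J(1)]
  have card: "card (J n) < d" for n using J(3)[of n] d by auto
  have ev1: "\<forall>\<^sub>F n in sequentially. k \<in> J n" if "k \<in> jumps x" for k
  proof -
    have "(\<lambda>n. f n k - f n (Suc k)) \<longlonglongrightarrow> x k - x (Suc k)" by (intro tendsto_diff lim)
    moreover have "0 < x k - x (Suc k)" using that by (simp add: jumps_def)
    ultimately have "\<forall>\<^sub>F n in sequentially. 0 < f n k - f n (Suc k)" by (rule order_tendstoD)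
    then show ?thesis
    proof eventually_elim
      case (elim n)
      then have "k \<in> jumps (f n)" using that by (simp add: jumps_def)
      then show ?case using J(2) by blast
    qed
  qed
  have ev2: "\<forall>\<^sub>F n in sequentially. S \<subseteq> J n" if "finite S" "S \<subseteq> jumps x" for S
  proof -
    have "\<forall>\<^sub>F n in sequentially. \<forall>k\<in>S. k \<in> J n"
      using that ev1 by (intro eventually_ball_finite) auto
    then show ?thesis by eventually_elim blast
  qed
  have finj: "finite (jumps x)"
  proof (rule ccontr)
    assume "infinite (jumps x)"
    then obtain S where S: "finite S" "card S = d" "S \<subseteq> jumps x"
      using infinite_arbitrarily_large by metis
    obtain n where "S \<subseteq> J n"
      using eventually_happens'[OF sequentially_bot ev2[OF S(1,3)]] by blast
    then show False using card_mono[OF fin, of S n] card[of n] S(2) by simp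
  qed
  have ev3: "\<forall>\<^sub>F n in sequentially. jumps x \<subseteq> J n" by (rule ev2[OF finj order_refl])
  show ?thesis
  proof (cases "\<exists>n. jumps x \<subseteq> J n \<and> (card (J n) = d - 2 \<or> psum 1 x = 1)")
    case True
    then obtain n where "jumps x \<subseteq> J n" "card (J n) = d - 2 \<or> psum 1 x = 1" by blast
    then show ?thesis using J(1)[of n] J(3)[of n] x unfolding gale_seqs_def by blast
  next
    case False
    obtain n0 where "jumps x \<subseteq> J n0" using eventually_happens'[OF sequentially_bot ev3] by blast
    then have "psum 1 x < 1" using False psum_1_le[OF kingmanD(1)[OF x]] by force
    \<comment> \<open>\<open>N\<close> lies beyond all drops of the limit, and \<open>N \<ge> 2\<close>, so that the pair removed below
    consists of positive numbers.\<close>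
    define N where "N = Suc (Max (insert 1 (jumps x)))"
    have N: "k < N" if "k \<in> jumps x" for k
      using that finj by (simp add: N_def less_Suc_eq_le)
    have "(\<Sum>i=1..N. x i) \<le> psum 1 x"
      unfolding psum_def sum_Suc_shift[symmetric]
      using sum_le_suminf[OF summable_mass_seq[OF kingmanD(1)[OF x], of 1], of "{..<N}"]
        kingmanD(4)[OF x] by simp
    then have lt: "(\<Sum>i=1..N. x i) < 1" using \<open>psum 1 x < 1\<close> by simp
    have "(\<lambda>n. \<Sum>i=1..N. f n i) \<longlonglongrightarrow> (\<Sum>i=1..N. x i)" by (intro tendsto_sum lim)
    then have "\<forall>\<^sub>F n in sequentially. (\<Sum>i=1..N. f n i) < 1" by (rule order_tendstoD(2)[OF _ lt])
    with ev3 have "\<forall>\<^sub>F n in sequentially. jumps x \<subseteq> J n \<and> (\<Sum>i=1..N. f n i) < 1"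
      by (rule eventually_conj)
    then obtain n where n: "jumps x \<subseteq> J n" "(\<Sum>i=1..N. f n i) < 1"
      using eventually_happens'[OF sequentially_bot] by blast
    have c: "card (J n) = d - 1" "psum 1 (f n) = 1" using J(3)[of n] n(1) False by blast+
    have "\<not> J n \<subseteq> {..N}"
    proof
      assume "J n \<subseteq> {..N}"
      then have "jumps (f n) \<subseteq> {..N}" using J(2)[of n] by blast
      then have "psum 1 (f n) = (\<Sum>i=1..N. f n i)"
        using psum_finite(2)[of N "f n" 1] kingman_zero_beyond_jumps[OF fK[of n]] by simp
      then show False using n(2) c(2) by simp
    qed
    then obtain L0 where L0: "L0 \<in> J n" "N < L0" by force
    define L where "L = Max (J n)"
    have L: "L \<in> J n" "\<And>j. j \<in> J n \<Longrightarrow> j \<le> L"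
      unfolding L_def using Max_in[OF fin[of n]] L0(1) Max_ge[OF fin[of n]] by blast+
    have NL: "N < L" using L0 L(2) by force
    then obtain k where k: "L = Suc k" by (cases L) auto
    have k1: "1 \<le> k" "N \<le> k" using NL k by (auto simp: N_def)
    have r: "k \<in> J n" "tail_even (J n - {k, Suc k})"
      using tail_even_remove_pair[OF J(1), of k n] L k k1 by auto
    obtain a where a: "a \<notin> J n - {k, Suc k}" "tail_even (insert a (J n - {k, Suc k}))"
      using tail_even_insert_least[OF r(2)] by blast
    have "card (J n - {k, Suc k}) = card (J n) - 2"
      using r(1) L(1) k by (subst card_Diff_subset) auto
    then have "card (insert a (J n - {k, Suc k})) = d - 2"
      using a(1) fin[of n] c(1) d by (subst card_insert_disjoint) auto
    moreover have "jumps x \<subseteq> insert a (J n - {k, Suc k})" using n(1) N k1(2) by force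
    ultimately show ?thesis using a(2) x unfolding gale_seqs_def by blast
  qed
qed

lemma closed_psum_vec_gale_seqs:
  fixes ix :: "'m::finite \<Rightarrow> nat"
  assumes d: "3 \<le> d" and ix: "\<And>j. 2 \<le> ix j"
  shows "closed (psum_vec ix ` gale_seqs d)"
  unfolding closed_sequential_limits
proof (intro allI impI, elim conjE)
  fix p l assume p: "\<forall>n. p n \<in> psum_vec ix ` gale_seqs d" "p \<longlonglongrightarrow> l"
  have "\<exists>f. \<forall>n. f n \<in> gale_seqs d \<and> p n = psum_vec ix (f n)"
    using p(1) by (intro choice) blast
  then obtain f where f: "\<And>n. f n \<in> gale_seqs d" "\<And>n. p n = psum_vec ix (f n)" by blast
  have fK: "f n \<in> kingman" for n using f(1)[of n] by (simp add: gale_seqs_def)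
  have "seq_compact kingman" by (rule compact_imp_seq_compact[OF compact_kingman])
  then obtain x r where x: "x \<in> kingman" "strict_mono r" "(f \<circ> r) \<longlonglongrightarrow> x"
    using fK by (metis seq_compactE)
  have coord: "(\<lambda>n. (f \<circ> r) n i) \<longlonglongrightarrow> x i" for i
    using continuous_on_tendsto_compose[OF continuous_on_product_coordinates[of i] x(3)] by simp
  have "x \<in> gale_seqs d"
    by (rule gale_seqs_limit[OF d _ x(1) coord]) (use f(1) in simp)
  moreover have "(\<lambda>n. psum_vec ix ((f \<circ> r) n)) \<longlonglongrightarrow> psum_vec ix x"
    by (rule continuous_on_tendsto_compose[OF continuous_on_psum_vec[OF ix] x(3) x(1)])
      (use fK in simp)
  then have "(p \<circ> r) \<longlonglongrightarrow> psum_vec ix x" using f(2) by (simp add: comp_def)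
  then have "l = psum_vec ix x"
    using LIMSEQ_subseq_LIMSEQ[OF p(2) x(2)] LIMSEQ_unique by blast
  ultimately show "l \<in> psum_vec ix ` gale_seqs d" by blast
qed

section \<open>Outward normals at the boundary\<close>

lemma psum_update:
  assumes "summable (\<lambda>n. x (Suc n) ^ k)" "1 \<le> i"
  shows "summable (\<lambda>n. (x(i := a)) (Suc n) ^ k)" "psum k (x(i := a)) = psum k x + (a ^ k - x i ^ k)"
proof -
  have "(\<lambda>n. x (Suc n) ^ k + (if n = i - 1 then a ^ k - x i ^ k else 0)) sums
      (psum k x + (a ^ k - x i ^ k))"
    unfolding psum_def
    by (intro sums_add summable_sums assms(1)) (use sums_single[of "i - 1" "\<lambda>_. a ^ k - x i ^ k"] in simp)
  moreover have "(\<lambda>n. x (Suc n) ^ k + (if n = i - 1 then a ^ k - x i ^ k else 0)) =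
      (\<lambda>n. (x(i := a)) (Suc n) ^ k)"
  proof
    fix n
    show "x (Suc n) ^ k + (if n = i - 1 then a ^ k - x i ^ k else 0) = (x(i := a)) (Suc n) ^ k"
      using assms(2) by (cases "Suc n = i") auto
  qed
  ultimately have "(\<lambda>n. (x(i := a)) (Suc n) ^ k) sums (psum k x + (a ^ k - x i ^ k))" by simp
  then show "summable (\<lambda>n. (x(i := a)) (Suc n) ^ k)" "psum k (x(i := a)) = psum k x + (a ^ k - x i ^ k)"
    unfolding psum_def by (auto simp: sums_iff)
qed

lemma mass_seq_update2:
  assumes x: "x \<in> mass_seq" and ij: "i \<noteq> j" "1 \<le> i" "1 \<le> j" and ab: "0 \<le> a" "0 \<le> b"
    and le: "psum 1 x + (a - x i) + (b - x j) \<le> 1"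
  shows "x(i := a, j := b) \<in> mass_seq"
    "1 \<le> k \<Longrightarrow> psum k (x(i := a, j := b)) - psum k x = (a ^ k - x i ^ k) + (b ^ k - x j ^ k)"
proof -
  have s: "summable (\<lambda>n. (x(i := a, j := b)) (Suc n) ^ k)"
    "psum k (x(i := a, j := b)) = psum k x + (a ^ k - x i ^ k) + (b ^ k - x j ^ k)"
    if "1 \<le> k" for k
  proof -
    note u = psum_update[OF summable_mass_seq[OF x that] ij(2), of a]
    show "summable (\<lambda>n. (x(i := a, j := b)) (Suc n) ^ k)"
      by (rule psum_update(1)[OF u(1) ij(3)])
    show "psum k (x(i := a, j := b)) = psum k x + (a ^ k - x i ^ k) + (b ^ k - x j ^ k)"
      using psum_update(2)[OF u(1) ij(3), of b] u(2) ij(1) by (simp del: fun_upd_apply add: fun_upd_other)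
  qed
  show "x(i := a, j := b) \<in> mass_seq"
  proof (rule mass_seqI)
    show "0 \<le> (x(i := a, j := b)) n" for n using mass_seqD(1)[OF x, of n] ab by simp
    show "summable (\<lambda>n. (x(i := a, j := b)) (Suc n))" using s(1)[of 1] by (simp only: power_one_right)
    show "psum 1 (x(i := a, j := b)) \<le> 1" using s(2)[of 1] le by simp
  qed
  show "psum k (x(i := a, j := b)) - psum k x = (a ^ k - x i ^ k) + (b ^ k - x j ^ k)" if "1 \<le> k"
    using s(2)[OF that] by simp
qed

lemma poly_nonpos_at_0:
  fixes H :: "real poly"
  assumes "0 < e" "\<And>s. 0 < s \<Longrightarrow> s < e \<Longrightarrow> poly H s \<le> 0"
  shows "poly H 0 \<le> 0"
proof (rule tendsto_upperbound[where F = "at_right 0" and f = "poly H"])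
  show "(poly H \<longlongrightarrow> poly H 0) (at_right 0)"
    using isContD[OF poly_isCont[of 0 H]] by (rule tendsto_mono[rotated]) (simp add: at_le)
  show "\<forall>\<^sub>F s in at_right 0. poly H s \<le> 0"
    using assms unfolding eventually_at_right[OF assms(1)] by auto
qed simp

lemma poly_local_max_right:
  fixes H :: "real poly"
  assumes e: "0 < e" "\<And>s. 0 < s \<Longrightarrow> s < e \<Longrightarrow> poly H s \<le> 0" and "poly H 0 = 0"
  shows "poly (pderiv H) 0 \<le> 0"
    "poly (pderiv H) 0 = 0 \<Longrightarrow> poly (pderiv (pderiv H)) 0 \<le> 0"
proof -
  obtain a H1 where "H = pCons a H1" by (cases H)
  then have H: "H = pCons 0 H1" using assms(3) by simp
  have H1: "poly H1 s \<le> 0" if "0 < s" "s < e" for s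
    using e(2)[OF that] that unfolding H by (simp add: mult_le_0_iff)
  show "poly (pderiv H) 0 \<le> 0"
    using poly_nonpos_at_0[OF e(1) H1] by (simp add: H pderiv_pCons)
  assume z: "poly (pderiv H) 0 = 0"
  obtain b H2 where "H1 = pCons b H2" by (cases H1)
  then have H2: "H1 = pCons 0 H2" using z by (simp add: H pderiv_pCons)
  have "poly H2 s \<le> 0" if "0 < s" "s < e" for s
    using H1[OF that] that unfolding H2 by (simp add: mult_le_0_iff)
  then have "poly H2 0 \<le> 0" using poly_nonpos_at_0[OF e(1)] by blast
  then show "poly (pderiv (pderiv H)) 0 \<le> 0" by (simp add: H H2 pderiv_pCons pderiv_add)
qed

lemma pderiv_sum: "pderiv (\<Sum>i\<in>A. f i) = (\<Sum>i\<in>A. pderiv (f i))"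
  by (induction A rule: infinite_finite_induct) (simp_all add: pderiv_add)

text \<open>
  The linear functional \<open>c\<close> on the vectors \<open>(p\<^sub>2, \<dots>, p\<^sub>d)\<close> takes the value \<open>\<Sum>\<^sub>i F(x\<^sub>i)\<close> at \<open>x\<close>, with this polynomial \<open>F\<close>.
\<close>

definition normal_poly :: "nat \<Rightarrow> (nat \<Rightarrow> real) \<Rightarrow> real poly" where
  "normal_poly d c = (\<Sum>k=2..d. monom (c k) k)"

text \<open>
  If \<open>z = \<nu>(x)\<close> is the point of \<open>\<Pi>\<^sub>d\<close> nearest to \<open>q\<close>, this holds for \<open>c = q - z\<close>; it is the inequality
  \<open>\<bar>q - z\<bar>\<^sup>2 \<le> \<bar>q - \<nu>(y)\<bar>\<^sup>2\<close>, expanded.  The quadratic error term influences neither the first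
  derivative along a curve through \<open>x\<close> nor, if the velocity of its image vanishes, the second.
\<close>

definition proximal :: "nat \<Rightarrow> (nat \<Rightarrow> real) \<Rightarrow> (nat \<Rightarrow> real) \<Rightarrow> bool" where
  "proximal d c x \<longleftrightarrow> (\<forall>y\<in>mass_seq. (\<Sum>k=2..d. c k * (psum k y - psum k x)) \<le>
    (\<Sum>k=2..d. (psum k y - psum k x)\<^sup>2) / 2)"

text \<open>
  The entries \<open>x i\<close> and \<open>x j\<close> are moved with constant velocities \<open>\<alpha>\<close> and \<open>\<beta>\<close>.  The resulting gain
  \<open>H\<close> is a polynomial in the time \<open>s\<close>, it vanishes at \<open>s = 0\<close>, and it is not positive as long as the moved sequence is
  admissible.  If the power sums do not change to first order, the second order term decides.
\<close>

lemma proximal_variation: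
  assumes prox: "proximal d c x" and x: "x \<in> mass_seq" and ij: "i \<noteq> j" "1 \<le> i" "1 \<le> j"
    and e: "0 < e" and feas: "\<And>s. 0 < s \<Longrightarrow> s < e \<Longrightarrow>
      0 \<le> x i + \<alpha> * s \<and> 0 \<le> x j + \<beta> * s \<and> psum 1 x + \<alpha> * s + \<beta> * s \<le> 1"
  defines "G \<equiv> pderiv (normal_poly d c)"
  shows "\<alpha> * poly G (x i) + \<beta> * poly G (x j) \<le> 0"
    "(\<And>k. 2 \<le> k \<Longrightarrow> k \<le> d \<Longrightarrow> \<alpha> * x i ^ (k - 1) + \<beta> * x j ^ (k - 1) = 0) \<Longrightarrow>
      \<alpha>\<^sup>2 * poly (pderiv G) (x i) + \<beta>\<^sup>2 * poly (pderiv G) (x j) \<le> 0"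
proof -
  define F where "F = normal_poly d c"
  have F: "poly F t = (\<Sum>k=2..d. c k * t ^ k)" for t
    by (simp add: F_def normal_poly_def poly_sum poly_monom)
  define A where "A = [:x i, \<alpha>:]"
  define B where "B = [:x j, \<beta>:]"
  define W where "W k = A ^ k + B ^ k - [:x i ^ k + x j ^ k:]" for k
  define H where "H = pcompose F A + pcompose F B - [:poly F (x i) + poly F (x j):]
    - (\<Sum>k=2..d. smult (1 / 2) (W k ^ 2))"
  have W: "poly (W k) s = (x i + \<alpha> * s) ^ k - x i ^ k + ((x j + \<beta> * s) ^ k - x j ^ k)" for k s
    by (simp add: W_def A_def B_def mult.commute)
  have W0: "poly (W k) 0 = 0" for k by (simp add: W)
  have neg: "poly H s \<le> 0" if s: "0 < s" "s < e" for s
  proof -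
    define y where "y = x(i := x i + \<alpha> * s, j := x j + \<beta> * s)"
    have y: "y \<in> mass_seq" "\<And>k. 1 \<le> k \<Longrightarrow> psum k y - psum k x = poly (W k) s"
      using mass_seq_update2[OF x ij, of "x i + \<alpha> * s" "x j + \<beta> * s"] feas[OF s]
      unfolding y_def W by auto
    have eq: "(\<Sum>k=2..d. g k (psum k y - psum k x)) = (\<Sum>k=2..d. g k (poly (W k) s))"
      for g :: "nat \<Rightarrow> real \<Rightarrow> real"
      by (intro sum.cong refl) (simp add: y(2))
    have "(\<Sum>k=2..d. c k * poly (W k) s) \<le> (\<Sum>k=2..d. (poly (W k) s)\<^sup>2) / 2"
      using prox y(1) eq[of "\<lambda>k w. c k * w"] eq[of "\<lambda>k w. w\<^sup>2"] unfolding proximal_def by auto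
    moreover have "(\<Sum>k=2..d. c k * poly (W k) s) =
        poly F (x i + \<alpha> * s) + poly F (x j + \<beta> * s) - (poly F (x i) + poly F (x j))"
      unfolding F W by (simp add: sum.distrib sum_subtractf algebra_simps)
    ultimately show ?thesis
      by (simp add: H_def poly_pcompose A_def B_def poly_sum mult.commute sum_divide_distrib)
  qed
  have H0: "poly H 0 = 0" by (simp add: H_def poly_pcompose A_def B_def poly_sum W0)
  have dA: "pderiv A = [:\<alpha>:]" "pderiv B = [:\<beta>:]" by (simp_all add: A_def B_def pderiv_pCons)
  have A0: "poly A 0 = x i" "poly B 0 = x j" by (simp_all add: A_def B_def)
  have dW: "pderiv (W k ^ 2) = smult 2 (W k * pderiv (W k))" for k
  proof -
    have "smult 2 p = p + p" for p :: "real poly"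
      by (metis one_add_one smult_1_left smult_add_left)
    then show ?thesis by (simp only: power2_eq_square pderiv_mult mult.commute[of "pderiv (W k)"])
  qed
  have dH: "pderiv H = pcompose G A * [:\<alpha>:] + pcompose G B * [:\<beta>:]
      - (\<Sum>k=2..d. W k * pderiv (W k))"
    unfolding H_def pderiv_diff pderiv_add pderiv_pcompose dA G_def F_def[symmetric] pderiv_smult
      pderiv_sum dW
    by (simp add: pderiv_pCons)
  have dH0: "poly (pderiv H) 0 = \<alpha> * poly G (x i) + \<beta> * poly G (x j)"
    unfolding dH by (simp add: poly_sum W0 poly_pcompose A0)
  show "\<alpha> * poly G (x i) + \<beta> * poly G (x j) \<le> 0"
    using poly_local_max_right(1)[OF e neg H0] dH0 by simp
  assume crit: "\<And>k. 2 \<le> k \<Longrightarrow> k \<le> d \<Longrightarrow> \<alpha> * x i ^ (k - 1) + \<beta> * x j ^ (k - 1) = 0"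
  have dW0: "poly (pderiv (W k)) 0 = 0" if "2 \<le> k" "k \<le> d" for k
  proof -
    have "poly (pderiv (W k)) 0 = real k * (\<alpha> * x i ^ (k - 1) + \<beta> * x j ^ (k - 1))"
      unfolding W_def pderiv_diff pderiv_add pderiv_power dA
      by (simp add: A0 algebra_simps pderiv_pCons)
    then show ?thesis using crit[OF that] by simp
  qed
  have "\<alpha> * poly G (x i) + \<beta> * poly G (x j) = 0"
  proof -
    have "poly G t = (\<Sum>k=2..d. real k * c k * t ^ (k - 1))" for t
      by (simp add: G_def normal_poly_def pderiv_sum pderiv_monom poly_sum poly_monom)
    then have "\<alpha> * poly G (x i) + \<beta> * poly G (x j) =
        (\<Sum>k=2..d. real k * c k * (\<alpha> * x i ^ (k - 1) + \<beta> * x j ^ (k - 1)))"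
      by (simp add: sum_distrib_left algebra_simps flip: sum.distrib)
    also have "\<dots> = 0" using crit by (intro sum.neutral) auto
    finally show ?thesis .
  qed
  moreover have "poly (pderiv (pderiv H)) 0 =
      \<alpha>\<^sup>2 * poly (pderiv G) (x i) + \<beta>\<^sup>2 * poly (pderiv G) (x j)"
  proof -
    have "poly (\<Sum>k=2..d. pderiv (W k * pderiv (W k))) 0 = 0"
      unfolding poly_sum pderiv_mult by (intro sum.neutral) (auto simp: W0 dW0)
    then show ?thesis
      unfolding dH pderiv_diff pderiv_add pderiv_mult pderiv_pcompose dA pderiv_sum
      by (simp add: poly_pcompose A0 power2_eq_square pderiv_pCons algebra_simps)
  qed
  ultimately show "\<alpha>\<^sup>2 * poly (pderiv G) (x i) + \<beta>\<^sup>2 * poly (pderiv G) (x j) \<le> 0"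
    using poly_local_max_right(2)[OF e neg H0] dH0 by simp
qed

text \<open>
  Here \<open>G = F'\<close> and \<open>Q = \<mu> - G\<close>.  Exchanging mass between positive entries shows that \<open>G\<close> takes a common value \<open>\<mu>\<close>
  at them, with \<open>\<mu> = 0\<close> if the sum is less than \<open>1\<close> and every entry can be changed alone.  Spreading two equal
  entries apart gives the slope condition, and a new entry at a zero of \<open>x\<close> gives the
  condition at \<open>0\<close>.  If the sum is less than \<open>1\<close>, then \<open>Q\<close> has a root at \<open>0\<close>; dividing it out saves one degree, which
  matches the size \<open>d - 2\<close> instead of \<open>d - 1\<close>.
\<close>

lemma proximal_imp_gale_seqs:
  assumes d: "3 \<le> d" and x: "x \<in> kingman" and prox: "proximal d c x"
    and c: "2 \<le> k0" "k0 \<le> d" "c k0 \<noteq> 0"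
  shows "x \<in> gale_seqs d"
proof -
  define G where "G = pderiv (normal_poly d c)"
  note xm = kingmanD(1)[OF x]
  note x0 = kingmanD(4)[OF x]
  note var = proximal_variation[OF prox xm, folded G_def]
  have G: "poly G t = (\<Sum>k=2..d. real k * c k * t ^ (k - 1))" for t
    by (simp add: G_def normal_poly_def pderiv_sum pderiv_monom poly_sum poly_monom)
  have coeffG: "coeff G (k0 - 1) = real k0 * c k0"
  proof -
    have "coeff G (k0 - 1) = (\<Sum>k=2..d. if k = k0 then real k * c k else 0)"
      unfolding G_def normal_poly_def pderiv_sum pderiv_monom coeff_sum coeff_monom
      by (intro sum.cong refl) (use c(1) in auto)
    then show ?thesis using c by simp
  qed
  have G0: "poly G 0 = 0" unfolding G by (intro sum.neutral) auto
  have degG: "degree G \<le> d - 1"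
    unfolding G_def degree_pderiv normal_poly_def
    by (intro diff_le_mono degree_sum_le) (auto intro: order_trans[OF degree_monom_le])
  define \<mu> where "\<mu> = (if psum 1 x = 1 then poly G (x 1) else 0)"
  have slack: "psum 1 x < 1" if "psum 1 x \<noteq> 1" using psum_1_le[OF xm] that by simp
  have crit: "poly G (x i) = \<mu>" if i: "1 \<le> i" "0 < x i" for i
  proof (cases "psum 1 x = 1")
    case full: True
    show ?thesis
    proof (cases "i = 1")
      case True
      then show ?thesis using full by (simp add: \<mu>_def)
    next
      case False
      have x1: "0 < x 1" using kingmanD(5)[OF x i(1)] i(2) by simp
      have "1 * poly G (x i) + - 1 * poly G (x 1) \<le> 0"
        by (rule var(1)[of i 1 "x 1" 1 "- 1"]) (use i False x1 full in auto)
      moreover have "- 1 * poly G (x i) + 1 * poly G (x 1) \<le> 0"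
        by (rule var(1)[of i 1 "x i" "- 1" 1]) (use i False x1 full in auto)
      ultimately show ?thesis using full by (simp add: \<mu>_def)
    qed
  next
    case False
    have "1 * poly G (x i) + 0 * poly G (x (Suc i)) \<le> 0"
      by (rule var(1)[of i "Suc i" "1 - psum 1 x" 1 0]) (use i x0 slack[OF False] in auto)
    moreover have "- 1 * poly G (x i) + 0 * poly G (x (Suc i)) \<le> 0"
      by (rule var(1)[of i "Suc i" "x i" "- 1" 0]) (use i x0 slack[OF False] in auto)
    ultimately show ?thesis using False by (simp add: \<mu>_def)
  qed
  define Q where "Q = [:\<mu>:] - G"
  have "coeff Q (k0 - 1) \<noteq> 0" using c coeffG by (simp add: Q_def coeff_pCons split: nat.splits)
  then have Q0: "Q \<noteq> 0" by auto
  have degQ: "degree Q \<le> d - 1" unfolding Q_def using degG by (intro degree_diff_le) auto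
  have rootQ: "poly Q (x j) = 0" if "j \<in> jumps x" for j
    using crit[of j] that x0[of "Suc j"] by (auto simp: Q_def jumps_def)
  have posJ: "0 < x j" if "j \<in> jumps x" for j
    using that x0[of "Suc j"] by (auto simp: jumps_def)
  have lessJ: "x j < x i" if "i \<in> jumps x" "j \<in> jumps x" "i < j" for i j
    using that kingmanD(5)[OF x, of "Suc i" j] by (auto simp: jumps_def)
  have finJ: "finite (jumps x)"
  proof (rule finite_imageD)
    show "finite (x ` jumps x)"
      by (rule finite_subset[OF _ poly_roots_finite[OF Q0]]) (use rootQ in auto)
    show "inj_on x (jumps x)"
      by (intro linorder_inj_onI') (use lessJ in fastforce)
  qed
  define N where "N = Max (insert 0 (jumps x))"
  have JN: "jumps x \<subseteq> {1..N}" using finJ by (auto simp: N_def jumps_def)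
  have zero: "x (Suc N) = 0"
    using kingman_zero_beyond_jumps[OF x, of N "Suc N"] JN by fastforce
  have derQ: "0 \<le> poly (pderiv Q) (x j)" if j: "j \<in> jumps x" "2 \<le> j" "j - 1 \<notin> jumps x" for j
  proof -
    have eq: "x (j - 1) = x j" using kingman_const[OF x order_refl, of "j - 1"] j by simp
    \<comment> \<open>Two equal entries are spread apart with velocities \<open>1\<close> and \<open>-1\<close>.\<close>
    have "1\<^sup>2 * poly (pderiv G) (x (j - 1)) + (- 1)\<^sup>2 * poly (pderiv G) (x j) \<le> 0"
    proof (rule var(2)[of "j - 1" j "x j" 1 "- 1"])
      show "0 \<le> x (j - 1) + 1 * s \<and> 0 \<le> x j + - 1 * s \<and> psum 1 x + 1 * s + - 1 * s \<le> 1"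
        if "0 < s" "s < x j" for s
        using that eq psum_1_le[OF xm] by simp
    qed (use j eq posJ in auto)
    then show ?thesis using eq by (simp add: Q_def pderiv_diff pderiv_pCons)
  qed
  show ?thesis
  proof (cases "psum 1 x = 1")
    case True
    have x1: "0 < x 1"
    proof (rule ccontr)
      assume "\<not> 0 < x 1"
      then have "x (Suc i) = 0" for i
        using kingmanD(5)[OF x, of 1 "Suc i"] x0[of "Suc i"] by simp
      then show False using True by (simp add: psum_def)
    qed
    have N1: "Suc N \<noteq> 1" using zero x1 by (metis less_irrefl)
    \<comment> \<open>The zero entry after the last drop grows at the expense of \<open>x\<^sub>1\<close>.\<close>
    have "1 * poly G (x (Suc N)) + - 1 * poly G (x 1) \<le> 0"
      by (rule var(1)[of "Suc N" 1 "x 1" 1 "- 1"]) (use zero x1 True N1 in auto)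
    then have "0 \<le> poly Q 0" using zero G0 True by (simp add: Q_def \<mu>_def)
    then obtain J where J: "tail_even J" "jumps x \<subseteq> J" "card J \<le> degree Q"
      using tail_even_cover_of_roots[of "jumps x" N x 0 Q] JN lessJ posJ Q0 rootQ derQ by blast
    obtain J' where "tail_even J'" "J \<subseteq> J'" "card J' = d - 1"
      by (rule tail_even_extend[OF J(1) order_trans[OF J(3) degQ]])
    then show ?thesis using True J(2) x unfolding gale_seqs_def by blast
  next
    case False
    have \<mu>0: "\<mu> = 0" using False by (simp add: \<mu>_def)
    have "poly Q 0 = 0" using G0 by (simp add: Q_def \<mu>0)
    obtain a Q1 where "Q = pCons a Q1" by (cases Q)
    then have Q1: "Q = pCons 0 Q1" using \<open>poly Q 0 = 0\<close> by simp
    have Q10: "Q1 \<noteq> 0" using Q0 Q1 by auto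
    have root1: "poly Q1 (x j) = 0" if "j \<in> jumps x" for j
      using rootQ[OF that] posJ[OF that] by (simp add: Q1)
    have der1: "0 \<le> poly (pderiv Q1) (x j)" if j: "j \<in> jumps x" "2 \<le> j" "j - 1 \<notin> jumps x" for j
      using derQ[OF j] posJ[OF j(1)] root1[OF j(1)] by (simp add: Q1 pderiv_pCons zero_le_mult_iff)
    \<comment> \<open>The zero entry grows alone; its effect is of second order, since all exponents are at least \<open>2\<close>.\<close>
    have "1\<^sup>2 * poly (pderiv G) (x (Suc N)) + 0\<^sup>2 * poly (pderiv G) (x (Suc (Suc N))) \<le> 0"
      by (rule var(2)[of "Suc N" "Suc (Suc N)" "1 - psum 1 x" 1 0])
        (use zero x0 slack[OF False] in auto)
    then have "0 \<le> poly (pderiv Q) 0" using zero by (simp add: Q_def pderiv_diff pderiv_pCons)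
    then have "0 \<le> poly Q1 0" by (simp add: Q1 pderiv_pCons)
    then obtain J where J: "tail_even J" "jumps x \<subseteq> J" "card J \<le> degree Q1"
      using tail_even_cover_of_roots[of "jumps x" N x 0 Q1] JN lessJ posJ Q10 root1 der1 by blast
    have degQ1: "degree Q1 \<le> d - 2" using degQ Q10 by (simp add: Q1)
    obtain J' where "tail_even J'" "J \<subseteq> J'" "card J' = d - 2"
      by (rule tail_even_extend[OF J(1) order_trans[OF J(3) degQ1]])
    then show ?thesis using J(2) x unfolding gale_seqs_def by blast
  qed
qed

text \<open>
  Close to a boundary point there is an exterior point \<open>q\<close>, and the point of \<open>\<Pi>\<^sub>d\<close> nearest to \<open>q\<close> is
  close to the given point as well.
\<close>

lemma frontier_subset_gale_seqs:
  fixes ix :: "'m::finite \<Rightarrow> nat"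
  assumes d: "3 \<le> d" and ix: "bij_betw ix UNIV {2..d}"
  shows "frontier (Pi_limit ix d) \<subseteq> psum_vec ix ` gale_seqs d"
proof
  fix p assume p: "p \<in> frontier (Pi_limit ix d)"
  define S where "S = Pi_limit ix d"
  have ix2: "2 \<le> ix j" for j using bij_betw_apply[OF ix, of j] by auto
  have S: "S = psum_vec ix ` kingman" unfolding S_def by (rule Pi_limit_eq[OF ix2])
  have "\<exists>z\<in>psum_vec ix ` gale_seqs d. dist z p < e" if e: "0 < e" for e
  proof -
    have "0 < e / 2" using e by simp
    then obtain p' q where p': "p' \<in> S" "dist p p' < e / 2" and q: "q \<notin> S" "dist p q < e / 2"
      using p unfolding frontier_straddle S_def by blast
    have "closed S" by (simp add: S_def Pi_limit_def)
    then obtain z where z: "z \<in> S" "\<And>y. y \<in> S \<Longrightarrow> dist q z \<le> dist q y"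
      using distance_attains_inf[of S q] p'(1) by blast
    have pS: "p \<in> S" using p \<open>closed S\<close> by (auto simp: frontier_def S_def)
    obtain x where x: "x \<in> kingman" "z = psum_vec ix x" using z(1) S by blast
    define c where "c k = (q - z) $ inv ix k" for k
    have inj: "inj ix" using ix by (simp add: bij_betw_def)
    have cix: "c (ix j) = (q - z) $ j" for j by (simp add: c_def inj)
    have "q \<noteq> z" using q(1) z(1) by auto
    then obtain j where "(q - z) $ j \<noteq> 0" by (metis eq_iff_diff_eq_0 vec_eq_iff zero_index)
    then have cj: "c (ix j) \<noteq> 0" by (simp add: cix)
    have "proximal d c x"
      unfolding proximal_def
    proof
      fix y assume y: "y \<in> mass_seq"
      define w where "w = psum_vec ix y - z"
      have wj: "w $ j = psum (ix j) y - psum (ix j) x" for j by (simp add: w_def x psum_vec_def)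
      have "psum_vec ix y \<in> S" unfolding S_def by (rule psum_vec_in_Pi_limit[OF y ix2])
      then have "norm (q - z) \<le> norm ((q - z) - w)"
        using z(2) by (simp add: dist_norm w_def)
      then have "(norm (q - z))\<^sup>2 \<le> (norm ((q - z) - w))\<^sup>2" by (intro power_mono) auto
      then have "inner (q - z) w \<le> inner w w / 2"
        by (simp add: power2_norm_eq_inner inner_diff_left inner_diff_right inner_commute)
      moreover have "inner (q - z) w = (\<Sum>k=2..d. c k * (psum k y - psum k x))"
        unfolding inner_vec_def
        by (subst sum.reindex_bij_betw[OF ix, symmetric]) (simp add: wj cix)
      moreover have "inner w w = (\<Sum>k=2..d. (psum k y - psum k x)\<^sup>2)"
        unfolding inner_vec_def
        by (subst sum.reindex_bij_betw[OF ix, symmetric]) (simp add: wj power2_eq_square)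
      ultimately show "(\<Sum>k=2..d. c k * (psum k y - psum k x)) \<le>
          (\<Sum>k=2..d. (psum k y - psum k x)\<^sup>2) / 2" by simp
    qed
    then have "x \<in> gale_seqs d"
      using proximal_imp_gale_seqs[OF d x(1), of c "ix j"] cj bij_betw_apply[OF ix, of j] by simp
    moreover have "dist z p < e"
      using z(2)[OF pS] q(2) dist_triangle[of z p q] by (simp add: dist_commute)
    ultimately show ?thesis using x(2) by blast
  qed
  then have "p \<in> closure (psum_vec ix ` gale_seqs d)" by (simp add: closure_approachable)
  also have "\<dots> = psum_vec ix ` gale_seqs d"
    by (intro closure_closed closed_psum_vec_gale_seqs d ix2)
  finally show "p \<in> psum_vec ix ` gale_seqs d" .
qed

section \<open>Patches\<close>

definition inverse_index :: "real set \<Rightarrow> nat set" where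
  "inverse_index R = {k. 1 \<le> k \<and> 1 / real k \<in> R}"

lemma inverse_index_image:
  assumes "R \<subseteq> T_inf"
  shows "R - {0} = (\<lambda>k. 1 / real k) ` inverse_index R"
proof
  show "R - {0} \<subseteq> (\<lambda>k. 1 / real k) ` inverse_index R"
  proof
    fix r assume r: "r \<in> R - {0}"
    then obtain k where "1 \<le> k" "r = 1 / real k" using assms by (auto simp: T_inf_def)
    then show "r \<in> (\<lambda>k. 1 / real k) ` inverse_index R" using r by (auto simp: inverse_index_def)
  qed
qed (auto simp: inverse_index_def)

lemma inj_on_inverse_real: "inj_on (\<lambda>k. 1 / real k) A"
  by (intro inj_onI) simp

lemma card_inverse_index:
  assumes "R \<subseteq> T_inf" "finite R"
  shows "finite (inverse_index R)" "card R = card (inverse_index R) + (if 0 \<in> R then 1 else 0)"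
proof -
  note eq = inverse_index_image[OF assms(1)]
  show "finite (inverse_index R)"
    using assms(2) eq inj_on_inverse_real by (metis finite_Diff finite_imageD)
  have "card (R - {0}) = card (inverse_index R)"
    unfolding eq by (rule card_image[OF inj_on_inverse_real])
  moreover have "card R = card (R - {0}) + (if 0 \<in> R then 1 else 0)"
    by (cases "0 \<in> R") (simp_all only: card.remove[OF assms(2)] if_True if_False Diff_empty
        Diff_insert0 add_Suc_right add_0_right One_nat_def not_False_eq_True)
  ultimately show "card R = card (inverse_index R) + (if 0 \<in> R then 1 else 0)" by simp
qed

lemma card_between:
  assumes "R \<subseteq> T_inf" "0 \<le> a"
  shows "card {r\<in>R. a < r \<and> r < b} = card {j\<in>inverse_index R. a < 1 / real j \<and> 1 / real j < b}"
proof -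
  have "{r\<in>R. a < r \<and> r < b} = {r\<in>R - {0}. a < r \<and> r < b}" using assms(2) by auto
  also have "\<dots> = (\<lambda>k. 1 / real k) ` {j\<in>inverse_index R. a < 1 / real j \<and> 1 / real j < b}"
    unfolding inverse_index_image[OF assms(1)] by auto
  finally show ?thesis by (simp add: card_image[OF inj_on_inverse_real])
qed

lemma inverse_real_less_iff:
  assumes "1 \<le> j" "1 \<le> k"
  shows "1 / real j < 1 / real k \<longleftrightarrow> k < j"
  using assms by (simp add: divide_simps)

text \<open>
  For the forward direction, a point \<open>1/m\<close> smaller than all nonzero elements of \<open>R\<close> serves as the left point of
  comparison; \<open>0\<close> itself may belong to \<open>R\<close>.
\<close>

lemma gale_even_iff_tail_even:
  assumes R: "R \<subseteq> T_inf" "finite R"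
  shows "gale_even T_inf R \<longleftrightarrow> tail_even (inverse_index R)"
proof -
  define J where "J = inverse_index R"
  have fin: "finite J" unfolding J_def by (rule card_inverse_index(1)[OF R])
  have J1: "1 \<le> j" if "j \<in> J" for j using that by (simp add: J_def inverse_index_def)
  have inT: "1 / real k \<in> T_inf - R \<longleftrightarrow> k \<notin> J" if "1 \<le> k" for k
    using that by (auto simp: J_def inverse_index_def T_inf_def)
  have btw: "{j\<in>J. 1 / real m < 1 / real j \<and> 1 / real j < 1 / real k} = {j\<in>J. k < j \<and> j < m}"
    if "1 \<le> k" "1 \<le> m" for k m
    using that J1 by (auto simp: inverse_real_less_iff)
  show ?thesis
  proof
    assume g: "gale_even T_inf R"
    show "tail_even (inverse_index R)"
      unfolding tail_even_def J_def[symmetric]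
    proof (intro conjI allI impI fin)
      fix b assume b: "1 \<le> b" "b \<notin> J"
      define m where "m = Suc (Max (insert b J))"
      have m: "j < m" if "j \<in> insert b J" for j
        using that fin by (auto simp: m_def less_Suc_eq_le)
      have "m \<notin> J" "b < m" "1 \<le> m" using m by (auto simp: m_def)
      then have "1 / real m \<in> T_inf - R" "1 / real b \<in> T_inf - R" "1 / real m < 1 / real b"
        using inT b by (auto simp: inverse_real_less_iff)
      then have "even (card {r\<in>R. 1 / real m < r \<and> r < 1 / real b})"
        using g unfolding gale_even_def by blast
      also have "card {r\<in>R. 1 / real m < r \<and> r < 1 / real b} = card {j\<in>J. b < j \<and> j < m}"
        using card_between[OF R(1), of "1 / real m" "1 / real b"] btw[OF b(1) \<open>1 \<le> m\<close>]
        by (simp add: J_def)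
      also have "{j\<in>J. b < j \<and> j < m} = {j\<in>J. b < j}" using m by auto
      finally show "even (card {j\<in>J. b < j})" .
    qed (use J1 in force)
  next
    assume t: "tail_even (inverse_index R)"
    note tD = tail_evenD[OF t, folded J_def]
    have "even (card {r\<in>R. a < r \<and> r < b})"
      if ab: "a \<in> T_inf - R" "b \<in> T_inf - R" "a < b" for a b
    proof -
      have a0: "0 \<le> a" using ab(1) by (auto simp: T_inf_def)
      then obtain k where k: "1 \<le> k" "b = 1 / real k" using ab(2,3) by (auto simp: T_inf_def)
      have kJ: "k \<notin> J" using ab(2) k inT by blast
      have kj: "1 / real j < b \<longleftrightarrow> k < j" if "j \<in> J" for j
        using k J1[OF that] by (simp add: inverse_real_less_iff)
      show ?thesis
      proof (cases "a = 0")
        case True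
        have "{j\<in>J. a < 1 / real j \<and> 1 / real j < b} = {j\<in>J. k < j}"
          using kj J1 True by force
        then show ?thesis using card_between[OF R(1) a0, of b] tD(3)[OF k(1) kJ] by (simp add: J_def)
      next
        case False
        then obtain m where m: "1 \<le> m" "a = 1 / real m" using ab(1) by (auto simp: T_inf_def)
        have mJ: "m \<notin> J" using ab(1) m inT by blast
        have km: "k < m" using ab(3) k m by (simp add: inverse_real_less_iff)
        have "{j\<in>J. k < j} = {j\<in>J. k < j \<and> j < m} \<union> {j\<in>J. m < j}"
          using km mJ by (auto simp: not_less) (metis le_neq_implies_less)
        then have "card {j\<in>J. k < j} = card {j\<in>J. k < j \<and> j < m} + card {j\<in>J. m < j}"
          using fin by (simp add: card_Un_disjoint disjoint_iff)
        then have "even (card {j\<in>J. k < j \<and> j < m})"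
          using tD(3)[OF k(1) kJ] tD(3)[OF m(1) mJ] by simp
        then show ?thesis
          using card_between[OF R(1) a0, of b] btw[OF k(1) m(1)] by (simp add: J_def k m)
      qed
    qed
    then show "gale_even T_inf R" using R by (simp add: gale_even_def)
  qed
qed

text \<open>
  The point of \<open>\<sigma>\<^sub>R\<close> with barycentric coordinates \<open>u\<close>, read backwards so that its entries decrease.
\<close>

definition vertex_mix :: "real set \<Rightarrow> (real \<Rightarrow> real) \<Rightarrow> nat \<Rightarrow> real" where
  "vertex_mix R u j = (if j = 0 then 1 else (\<Sum>r\<in>R. u r * rev_vertex r j))"

lemma rev_vertex_inverse:
  assumes "1 \<le> k"
  shows "rev_vertex (1 / real k) j = (if j \<le> k then 1 / real k else 0)"
  using assms by (simp add: rev_vertex_def divide_simps)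

lemma sum_rev_vertex:
  assumes "r \<in> T_fin n"
  shows "(\<Sum>j=1..n. rev_vertex r j) = (if r = 0 then 0 else 1)"
proof (cases "r = 0")
  case False
  then obtain k where k: "1 \<le> k" "k \<le> n" "r = 1 / real k" using assms by (auto simp: T_fin_def)
  have "(\<Sum>j=1..n. rev_vertex r j) = (\<Sum>j=1..n. if j \<le> k then 1 / real k else 0)"
    unfolding k(3) rev_vertex_inverse[OF k(1)] ..
  also have "\<dots> = (\<Sum>j=1..k. 1 / real k)"
    using k by (intro sum.mono_neutral_cong_right) auto
  finally show ?thesis using False k by simp
qed (simp add: rev_vertex_def)

lemma sum_vertex_mix:
  assumes "R \<subseteq> T_fin n" "finite R"
  shows "(\<Sum>j=1..n. vertex_mix R u j) = sum u (R - {0})"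
proof -
  have "(\<Sum>j=1..n. vertex_mix R u j) = (\<Sum>j=1..n. \<Sum>r\<in>R. u r * rev_vertex r j)"
    by (simp add: vertex_mix_def)
  also have "\<dots> = (\<Sum>r\<in>R. u r * (\<Sum>j=1..n. rev_vertex r j))"
    by (subst sum.swap) (simp add: sum_distrib_left)
  also have "\<dots> = (\<Sum>r\<in>R. if r = 0 then 0 else u r)"
    by (intro sum.cong refl) (use assms(1) sum_rev_vertex[of _ n] in auto)
  also have "\<dots> = sum u (R - {0})"
    using assms(2) by (intro sum.mono_neutral_cong_right) auto
  finally show ?thesis .
qed

lemma T_fin_subset_T_inf: "T_fin n \<subseteq> T_inf"
  by (auto simp: T_fin_def T_inf_def)

text \<open>
  Among the vertices only the one for \<open>1/k\<close> drops after the index \<open>k\<close>, and each vertex other than \<open>0\<close> has sum \<open>1\<close>.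
\<close>

lemma vertex_mix_kingman:
  assumes R: "R \<subseteq> T_fin n" "finite R" and u: "\<forall>r\<in>R. 0 \<le> u r" "sum u R = 1"
  shows "vertex_mix R u \<in> kingman" "jumps (vertex_mix R u) \<subseteq> inverse_index R"
    "0 \<notin> R \<Longrightarrow> psum 1 (vertex_mix R u) = 1"
    "1 \<le> k \<Longrightarrow> psum k (vertex_mix R u) = power_sum n k (\<lambda>i. \<Sum>r\<in>R. u r * vertex n r i)"
proof -
  define x where "x = vertex_mix R u"
  have R0: "0 \<le> r" if "r \<in> R" for r using that R(1) by (auto simp: T_fin_def)
  have rv0: "0 \<le> rev_vertex r j" if "r \<in> R" for r j using R0[OF that] by (simp add: rev_vertex_def)
  have x0: "0 \<le> x j" for j
    unfolding x_def vertex_mix_def using u(1) rv0 by (auto intro!: sum_nonneg)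
  have zero: "x j = 0" if "n < j" for j
    using that R(1) rev_vertex_zero[of _ n j] by (auto simp: x_def vertex_mix_def intro!: sum.neutral)
  have sum: "psum 1 x = sum u (R - {0})"
    using psum_finite(2)[of n x 1] zero sum_vertex_mix[OF R] by (simp add: x_def)
  also have "\<dots> \<le> sum u R" using u(1) R(2) by (intro sum_mono2) auto
  finally have le: "psum 1 x \<le> 1" using u(2) by simp
  have mass: "x \<in> mass_seq"
    using x0 le psum_finite(1)[of n x 1] zero by (intro mass_seqI) (auto simp: sums_iff)
  have rv_dec: "rev_vertex r (Suc j) \<le> rev_vertex r j" if "r \<in> R" for r j
  proof -
    have "real j * r \<le> real (Suc j) * r" using R0[OF that] by (intro mult_right_mono) auto
    then show ?thesis using R0[OF that] by (auto simp: rev_vertex_def)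
  qed
  have "antimono x"
    unfolding decseq_Suc_iff
  proof
    fix j
    show "x (Suc j) \<le> x j"
    proof (cases "j = 0")
      case True
      then show ?thesis using mass_seq_le_1[OF mass, of 1] by (simp add: x_def vertex_mix_def)
    next
      case False
      then show ?thesis unfolding x_def vertex_mix_def
        using u(1) rv_dec by (auto intro!: sum_mono mult_left_mono)
    qed
  qed
  then show "vertex_mix R u \<in> kingman"
    using mass by (auto simp: kingman_def x_def vertex_mix_def)
  show "jumps (vertex_mix R u) \<subseteq> inverse_index R"
  proof
    fix j assume j: "j \<in> jumps (vertex_mix R u)"
    have "\<exists>r\<in>R. rev_vertex r (Suc j) \<noteq> rev_vertex r j"
    proof (rule ccontr)
      assume "\<not> ?thesis"
      then have "vertex_mix R u (Suc j) = vertex_mix R u j"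
        using j by (auto simp: vertex_mix_def jumps_def intro!: sum.cong)
      then show False using j by (simp add: jumps_def)
    qed
    then obtain r where r: "r \<in> R" "rev_vertex r (Suc j) \<noteq> rev_vertex r j" by blast
    then have "r \<noteq> 0" by (auto simp: rev_vertex_def)
    then obtain k where k: "1 \<le> k" "r = 1 / real k" using r(1) R(1) by (auto simp: T_fin_def)
    have "k = j" using r(2) unfolding k(2) rev_vertex_inverse[OF k(1)] by (auto split: if_splits)
    then show "j \<in> inverse_index R" using k r(1) by (simp add: inverse_index_def)
  qed
  show "psum 1 (vertex_mix R u) = 1" if "0 \<notin> R"
    using sum u(2) that by (simp add: x_def)
  show "psum k (vertex_mix R u) = power_sum n k (\<lambda>i. \<Sum>r\<in>R. u r * vertex n r i)" if "1 \<le> k"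
  proof -
    have "power_sum n k (\<lambda>i. \<Sum>r\<in>R. u r * vertex n r i) = (\<Sum>j=1..n. (\<Sum>r\<in>R. u r * rev_vertex r j) ^ k)"
      using that by (intro power_sum_combination[OF R(1)]) auto
    also have "\<dots> = (\<Sum>j=1..n. x j ^ k)" by (simp add: x_def vertex_mix_def)
    also have "\<dots> = psum k x" using psum_finite(2)[of n x k] zero that by simp
    finally show ?thesis by (simp add: x_def)
  qed
qed

text \<open>
  The barycentric coordinate of the vertex for \<open>1/k\<close> is \<open>k (x\<^sub>k - x\<^bsub>k+1\<^esub>)\<close>, by summation by parts; the missing mass is
  the coordinate of the vertex \<open>0\<close>.
\<close>

lemma kingman_vertex_mix:
  assumes R: "R \<subseteq> T_fin n" "finite R" and x: "x \<in> kingman" "jumps x \<subseteq> inverse_index R"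
    and full: "0 \<notin> R \<Longrightarrow> psum 1 x = 1"
  obtains u where "\<forall>r\<in>R. 0 \<le> u r" "sum u R = 1" "x = vertex_mix R u"
proof -
  define J where "J = inverse_index R"
  \<comment> \<open>The index \<open>k\<close> is recovered from \<open>r = 1/k\<close> by the floor function.\<close>
  define u :: "real \<Rightarrow> real" where "u r = (if r = 0 then 1 - psum 1 x else
    (let k = nat \<lfloor>1 / r\<rfloor> in real k * (x k - x (Suc k))))" for r
  have RT: "R \<subseteq> T_inf" using R(1) T_fin_subset_T_inf by blast
  have uk: "u (1 / real k) = real k * (x k - x (Suc k))" if "1 \<le> k" for k
    using that by (simp add: u_def)
  have J: "1 \<le> k" "k \<le> n" if "k \<in> J" for k
  proof -
    show k: "1 \<le> k" using that by (simp add: J_def inverse_index_def)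
    have "1 / real k \<in> T_fin n" using that R(1) by (auto simp: J_def inverse_index_def)
    then show "k \<le> n" using k by (auto simp: T_fin_def)
  qed
  have "jumps x \<subseteq> {..n}" using x(2) J(2) by (auto simp: J_def)
  then have zero: "x j = 0" if "n < j" for j
    using kingman_zero_beyond_jumps[OF x(1)] that by blast
  have u0: "0 \<le> u r" if r: "r \<in> R" for r
  proof (cases "r = 0")
    case True
    then show ?thesis using psum_1_le[OF kingmanD(1)[OF x(1)]] by (simp add: u_def)
  next
    case False
    then obtain k where "1 \<le> k" "r = 1 / real k" using r RT by (auto simp: T_inf_def)
    then show ?thesis using uk kingmanD(5)[OF x(1), of k "Suc k"] by simp
  qed
  have eq: "x j = vertex_mix R u j" for j
  proof (cases "j = 0")
    case True
    then show ?thesis using kingmanD(2)[OF x(1)] by (simp add: vertex_mix_def)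
  next
    case False
    have "(\<Sum>r\<in>R. u r * rev_vertex r j) = (\<Sum>r\<in>R - {0}. u r * rev_vertex r j)"
      using R(2) by (intro sum.mono_neutral_right) (auto simp: rev_vertex_def)
    also have "\<dots> = (\<Sum>k\<in>J. u (1 / real k) * rev_vertex (1 / real k) j)"
      unfolding inverse_index_image[OF RT] J_def
      by (simp add: sum.reindex[OF inj_on_inverse_real])
    also have "\<dots> = (\<Sum>k\<in>J. if j \<le> k then x k - x (Suc k) else 0)"
    proof (intro sum.cong refl)
      fix k assume "k \<in> J"
      then show "u (1 / real k) * rev_vertex (1 / real k) j = (if j \<le> k then x k - x (Suc k) else 0)"
        using J(1)[of k] uk[of k] by (simp add: rev_vertex_inverse)
    qed
    also have "\<dots> = (\<Sum>k=j..<max j (Suc n). x k - x (Suc k))"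
    proof (rule sum.mono_neutral_cong)
      show "finite J" unfolding J_def by (rule card_inverse_index(1)[OF RT R(2)])
      show "x k - x (Suc k) = 0" if "k \<in> {j..<max j (Suc n)} - J" for k
        using kingman_const[OF x(1,2), of k] that False by (simp add: J_def)
      show "(if j \<le> k then x k - x (Suc k) else 0) = 0" if "k \<in> J - {j..<max j (Suc n)}" for k
        using that J(2)[of k] by auto
    qed auto
    also have "\<dots> = x j - x (max j (Suc n))"
      using sum_Suc_diff'[of j "max j (Suc n)" x] by (simp add: sum_subtractf)
    also have "\<dots> = x j" using zero[of j] zero[of "Suc n"] by (auto simp: max_def)
    finally show ?thesis using False by (simp add: vertex_mix_def)
  qed
  have "psum 1 x = (\<Sum>j=1..n. x j)" using psum_finite(2)[of n x 1] zero by simp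
  also have "\<dots> = (\<Sum>j=1..n. vertex_mix R u j)" using eq by simp
  also have "\<dots> = sum u (R - {0})" by (rule sum_vertex_mix[OF R])
  finally have s: "psum 1 x = sum u (R - {0})" .
  have "sum u R = 1"
  proof (cases "0 \<in> R")
    case True
    then have "sum u R = u 0 + sum u (R - {0})" using R(2) by (simp add: sum.remove)
    then show ?thesis using s by (simp add: u_def)
  qed (use s full in simp)
  then show ?thesis using that[of u] u0 eq by blast
qed

lemma patch_subset_Pi_tilde:
  fixes ix :: "'m::finite \<Rightarrow> nat"
  assumes ix: "bij_betw ix UNIV {2..d}" and n: "d \<le> n" and R: "R \<subseteq> T_fin n" "finite R"
  shows "patch ix d R \<subseteq> Pi_tilde_set ix n"
proof -
  have "x \<in> full_simplex n" if x: "x \<in> patch_simplex n R" for x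
  proof -
    obtain u where u: "x = (\<lambda>i. \<Sum>r\<in>R. u r * vertex n r i)" "\<forall>r\<in>R. 0 \<le> u r" "sum u R = 1"
      using x[unfolded patch_simplex_eq[OF R(1)]] by (elim CollectE exE conjE)
    have "power_sum n 1 x = psum 1 (vertex_mix R u)"
      unfolding u(1) by (rule vertex_mix_kingman(4)[OF R u(2,3), symmetric]) simp
    also have "\<dots> \<le> 1" by (intro psum_1_le kingmanD(1) vertex_mix_kingman(1)[OF R u(2,3)])
    finally have le: "(\<Sum>i=1..n. x i) \<le> 1" by (simp add: power_sum_def)
    have "0 \<le> vertex n r i" if "r \<in> R" for r i
      using that R(1) by (auto simp: vertex_def rev_vertex_def T_fin_def)
    then have "0 \<le> x i" for i using u(1,2) by (auto intro!: sum_nonneg)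
    moreover have "x i = 0" if "i \<notin> {1..n}" for i
      using that unfolding u(1) vertex_def by (auto intro!: sum.neutral)
    ultimately show ?thesis using le unfolding full_simplex_def by blast
  qed
  then show ?thesis unfolding patch_eq[OF ix n R(1)] Pi_tilde_set_def by blast
qed

lemma patch_eq_psum_vec:
  fixes ix :: "'m::finite \<Rightarrow> nat"
  assumes ix: "bij_betw ix UNIV {2..d}" and n: "d \<le> n" and R: "R \<subseteq> T_fin n" "finite R"
  shows "patch ix d R =
    psum_vec ix ` {x\<in>kingman. jumps x \<subseteq> inverse_index R \<and> (0 \<notin> R \<longrightarrow> psum 1 x = 1)}"
proof -
  have ix1: "1 \<le> ix j" for j using bij_betw_apply[OF ix, of j] by auto
  have vec: "vandermonde_map ix n (\<lambda>i. \<Sum>r\<in>R. u r * vertex n r i) = psum_vec ix (vertex_mix R u)"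
    if "\<forall>r\<in>R. 0 \<le> u r" "sum u R = 1" for u
    using vertex_mix_kingman(4)[OF R that ix1] by (simp add: vandermonde_map_def psum_vec_def)
  show ?thesis
    unfolding patch_eq[OF ix n R(1)] patch_simplex_eq[OF R(1)]
  proof (intro equalityI subsetI)
    fix p assume "p \<in> vandermonde_map ix n ` {\<lambda>i. \<Sum>r\<in>R. u r * vertex n r i |u.
      (\<forall>r\<in>R. 0 \<le> u r) \<and> sum u R = 1}"
    then obtain u where u: "\<forall>r\<in>R. 0 \<le> u r" "sum u R = 1"
      "p = vandermonde_map ix n (\<lambda>i. \<Sum>r\<in>R. u r * vertex n r i)" by blast
    show "p \<in> psum_vec ix ` {x\<in>kingman. jumps x \<subseteq> inverse_index R \<and> (0 \<notin> R \<longrightarrow> psum 1 x = 1)}"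
      using vertex_mix_kingman[OF R u(1,2)] vec[OF u(1,2)] u(3) by blast
  next
    fix p assume "p \<in> psum_vec ix ` {x\<in>kingman. jumps x \<subseteq> inverse_index R \<and> (0 \<notin> R \<longrightarrow> psum 1 x = 1)}"
    then obtain x where x: "x \<in> kingman" "jumps x \<subseteq> inverse_index R" "0 \<notin> R \<Longrightarrow> psum 1 x = 1"
      "p = psum_vec ix x" by blast
    obtain u where u: "\<forall>r\<in>R. 0 \<le> u r" "sum u R = 1" "x = vertex_mix R u"
      using kingman_vertex_mix[OF R x(1-3)] by blast
    then have "p = vandermonde_map ix n (\<lambda>i. \<Sum>r\<in>R. u r * vertex n r i)"
      using vec[OF u(1,2)] x(4) by simp
    then show "p \<in> vandermonde_map ix n ` {\<lambda>i. \<Sum>r\<in>R. u r * vertex n r i |u.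
      (\<forall>r\<in>R. 0 \<le> u r) \<and> sum u R = 1}" using u(1,2) by blast
  qed
qed

lemma eventually_subset_T_fin:
  assumes "R \<subseteq> T_inf" "finite R"
  shows "\<forall>\<^sub>F n in sequentially. R \<subseteq> T_fin n"
proof -
  have "\<forall>\<^sub>F n in sequentially. r \<in> T_fin n" if r: "r \<in> R" for r
  proof (cases "r = 0")
    case False
    moreover have "r \<in> T_inf" using r assms(1) by blast
    ultimately obtain k where k: "1 \<le> k" "r = 1 / real k" unfolding T_inf_def by blast
    show ?thesis
      using eventually_ge_at_top[of k]
    proof eventually_elim
      case (elim n)
      then show ?case using k unfolding T_fin_def by blast
    qed
  qed (simp add: T_fin_def)
  then have "\<forall>\<^sub>F n in sequentially. \<forall>r\<in>R. r \<in> T_fin n"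
    using assms(2) by (intro eventually_ball_finite) auto
  then show ?thesis by eventually_elim blast
qed

text \<open>
  The size of \<open>R\<close> exceeds that of its index set by one exactly if \<open>0 \<in> R\<close>, which is why two sizes occur in \<open>gale_seqs\<close>.
\<close>

lemma Union_patches:
  fixes ix :: "'m::finite \<Rightarrow> nat"
  assumes d: "3 \<le> d" and ix: "bij_betw ix UNIV {2..d}"
  shows "(\<Union>R\<in>{R. R \<subseteq> T_inf \<and> card R = d - 1 \<and> gale_even T_inf R}. patch ix d R) =
    psum_vec ix ` gale_seqs d"
proof -
  have patch: "patch ix d R =
      psum_vec ix ` {x\<in>kingman. jumps x \<subseteq> inverse_index R \<and> (0 \<notin> R \<longrightarrow> psum 1 x = 1)}"
    if R: "R \<subseteq> T_inf" "finite R" for R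
  proof -
    obtain n where "R \<subseteq> T_fin n" "d \<le> n"
      using eventually_happens'[OF sequentially_bot
        eventually_conj[OF eventually_subset_T_fin[OF R] eventually_ge_at_top[of d]]] by blast
    then show ?thesis by (intro patch_eq_psum_vec ix R)
  qed
  show ?thesis
  proof (intro equalityI subsetI)
    fix p assume "p \<in> (\<Union>R\<in>{R. R \<subseteq> T_inf \<and> card R = d - 1 \<and> gale_even T_inf R}. patch ix d R)"
    then obtain R where R: "R \<subseteq> T_inf" "card R = d - 1" "gale_even T_inf R" "p \<in> patch ix d R"
      by blast
    have fin: "finite R" using R(3) by (simp add: gale_even_def)
    obtain x where x: "x \<in> kingman" "jumps x \<subseteq> inverse_index R" "0 \<notin> R \<longrightarrow> psum 1 x = 1"
      "p = psum_vec ix x" using R(4) patch[OF R(1) fin] by blast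
    have "tail_even (inverse_index R)" using R gale_even_iff_tail_even[OF R(1) fin] by simp
    moreover have "card (inverse_index R) = d - 1 \<and> psum 1 x = 1 \<or> card (inverse_index R) = d - 2"
      using card_inverse_index(2)[OF R(1) fin] R(2) x(3) by (cases "0 \<in> R") auto
    ultimately have "x \<in> gale_seqs d" using x unfolding gale_seqs_def by blast
    then show "p \<in> psum_vec ix ` gale_seqs d" using x(4) by blast
  next
    fix p assume "p \<in> psum_vec ix ` gale_seqs d"
    then obtain x where x: "x \<in> gale_seqs d" "p = psum_vec ix x" by blast
    then obtain J where J: "x \<in> kingman" "tail_even J" "jumps x \<subseteq> J"
      "card J = d - 1 \<and> psum 1 x = 1 \<or> card J = d - 2" by (auto simp: gale_seqs_def)
    define R where "R = (\<lambda>k. 1 / real k) ` J \<union> (if card J = d - 1 then {} else {0})"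
    have J1: "1 \<le> j" if "j \<in> J" for j using that tail_evenD(2)[OF J(2)] by (cases j) auto
    have idx: "inverse_index R = J" using J1 by (force simp: inverse_index_def R_def)
    have RT: "R \<subseteq> T_inf" using J1 by (auto simp: R_def T_inf_def)
    have fin: "finite R" using tail_evenD(1)[OF J(2)] by (simp add: R_def)
    have R0: "0 \<in> R \<longleftrightarrow> card J \<noteq> d - 1" using J1 by (force simp: R_def)
    have "card R = d - 1"
      using card_inverse_index(2)[OF RT fin] R0 J(4) d unfolding idx by auto
    moreover have "gale_even T_inf R" using gale_even_iff_tail_even[OF RT fin] idx J(2) by simp
    moreover have "p \<in> patch ix d R"
      unfolding patch[OF RT fin] idx x(2) using J R0 d by (intro imageI) auto
    ultimately show "p \<in> (\<Union>R\<in>{R. R \<subseteq> T_inf \<and> card R = d - 1 \<and> gale_even T_inf R}. patch ix d R)"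
      using RT by blast
  qed
qed

theorem theorem4p4:
  fixes d :: nat and ix :: "'m::finite \<Rightarrow> nat"
  assumes "d \<ge> 3"
    and "bij_betw ix UNIV {2..d}"
  shows "frontier (Pi_limit ix d) =
      (\<Union>R\<in>{R. R \<subseteq> T_inf \<and> card R = d - 1 \<and> gale_even T_inf R}. patch ix d R)
    \<and> (\<forall>R. R \<subseteq> T_inf \<and> card R = d - 1 \<and> gale_even T_inf R \<longrightarrow>
        (\<forall>\<^sub>F n in sequentially.
          R \<subseteq> T_fin n \<and> gale_even (T_fin n) R \<and> patch ix d R \<subseteq> frontier (Pi_tilde_set ix n)))"
proof (intro conjI allI impI)
  have ix2: "2 \<le> ix j" for j using bij_betw_apply[OF assms(2), of j] by auto
  have "2 \<le> d" using assms(1) by simp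
  then have "psum_vec ix ` gale_seqs d \<subseteq> frontier (Pi_limit ix d)"
    by (intro image_subsetI gale_seqs_frontier assms(2))
  then show eq: "frontier (Pi_limit ix d) =
      (\<Union>R\<in>{R. R \<subseteq> T_inf \<and> card R = d - 1 \<and> gale_even T_inf R}. patch ix d R)"
    using frontier_subset_gale_seqs[OF assms] unfolding Union_patches[OF assms] by (intro equalityI)
  fix R assume R: "R \<subseteq> T_inf \<and> card R = d - 1 \<and> gale_even T_inf R"
  then have fin: "finite R" by (simp add: gale_even_def)
  have bd: "patch ix d R \<subseteq> frontier (Pi_limit ix d)" unfolding eq using R by blast
  show "\<forall>\<^sub>F n in sequentially.
      R \<subseteq> T_fin n \<and> gale_even (T_fin n) R \<and> patch ix d R \<subseteq> frontier (Pi_tilde_set ix n)"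
    using eventually_subset_T_fin[OF conjunct1[OF R] fin] eventually_ge_at_top[of d]
  proof eventually_elim
    case (elim n)
    have "gale_even (T_fin n) R"
      using R elim(1) T_fin_subset_T_inf[of n] unfolding gale_even_def by blast
    moreover have "patch ix d R \<subseteq> closure (Pi_tilde_set ix n)"
      using patch_subset_Pi_tilde[OF assms(2) elim(2,1) fin] closure_subset by blast
    moreover have "interior (Pi_tilde_set ix n) \<subseteq> interior (Pi_limit ix d)"
      by (intro interior_mono Pi_tilde_subset_Pi_limit ix2)
    ultimately show ?case using elim(1) bd by (auto simp: frontier_def)
  qed
qed

end
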